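(* Let $A\in\mathbb{R}^{n\times n}$ and $D\in\mathbb{R}^{n\times n}$ be such that both $A$ and $B=A+D$ are symmetric positive definite, and $D$ has rank $k$. Let $\Delta=B^{1/2}-A^{1/2}$. Then for $j\geq1$ (and integers $l\geq0$ with $j+kl\leq n$), the singular values of $\Delta$ satisfy \[ \sigma_{j+kl}(\Delta)\leq4\left[\exp\left(\frac{\pi^{2}}{2\log(4\hat{\kappa})}\right)\right]^{-2l}\sigma_{j}(\Delta), \] where \[ \hat{\kappa}=\frac{2\left(\sqrt{\|A\|_{2}+\|D\|_{2}}+\sqrt{\lambda_{\min}(A)}/2\right)}{\sqrt{\lambda_{\min}(A)}}. \]
   Context: For a symmetric positive (semi)definite matrix $M$, $M^{1/2}$ denotes its principal (positive semidefinite) square root. $\sigma_i(\cdot)$ denotes the $i$-th largest singular value, $\|\cdot\|_2$ the spectral norm, and $\lambda_{\min}(\cdot)$ the smallest eigenvalue. *)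

theory Defs
  imports "HOL-Analysis.Analysis" "HOL-Computational_Algebra.Polynomial"
begin

definition sym_mat :: "real^'n^'n \<Rightarrow> bool" where
  "sym_mat M \<longleftrightarrow> transpose M = M"

definition pos_def :: "real^'n^'n \<Rightarrow> bool" where
  "pos_def M \<longleftrightarrow> sym_mat M \<and> (\<forall>x. x \<noteq> 0 \<longrightarrow> x \<bullet> (M *v x) > 0)"

definition pos_semidef :: "real^'n^'n \<Rightarrow> bool" where
  "pos_semidef M \<longleftrightarrow> sym_mat M \<and> (\<forall>x. x \<bullet> (M *v x) \<ge> 0)"

definition mat_sqrt :: "real^'n^'n \<Rightarrow> real^'n^'n" where
  "mat_sqrt M = (THE S. pos_semidef S \<and> S ** S = M)"

definition char_poly :: "real^'n^'n \<Rightarrow> real poly" where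
  "char_poly M = det (\<chi> i j. (if i = j then [:0, 1:] else 0) - [:M $ i $ j:])"

definition eigenvalues_desc :: "real^'n^'n \<Rightarrow> real list" where
  "eigenvalues_desc M = rev (sorted_list_of_multiset (proots (char_poly M)))"

definition sing_val :: "real^'n^'n \<Rightarrow> nat \<Rightarrow> real" where
  "sing_val M i = sqrt (eigenvalues_desc (transpose M ** M) ! (i - 1))"

definition lambda_min :: "real^'n^'n \<Rightarrow> real" where
  "lambda_min M = Min (set_mset (proots (char_poly M)))"

definition norm2 :: "real^'n^'n \<Rightarrow> real" where
  "norm2 M = onorm (\<lambda>x. M *v x)"

end

theory Submission
  imports Defs "HOL-Computational_Algebra.Fundamental_Theorem_Algebra"
begin

text \<open>With \<open>s = sqrt (lambda_min A) / 2\<close>, the difference \<open>\<Delta>\<close> of the square roots satisfies the Sylvester equation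
  \<open>P \<Delta> + \<Delta> Q = D\<close> for \<open>P = mat_sqrt (A + D) + s\<close> and \<open>Q = mat_sqrt A - s\<close>, both with spectrum in an interval
  \<open>[a, b]\<close> with \<open>b / a = \<kappa>\<close>. For \<open>r(t) = \<Prod>i<l. (t - p\<^sub>i) / (t + p\<^sub>i)\<close> the matrix \<open>\<Delta> - r(P) \<Delta> r(Q)\<close>
  has rank at most \<open>k l\<close>, so the Courant--Fischer principle bounds \<open>\<sigma>\<^bsub>j+kl\<^esub>(\<Delta>)\<close> by
  \<open>(max |r|)\<^sup>2 \<sigma>\<^sub>j(\<Delta>)\<close>, the maximum being over \<open>[a, b]\<close>.

  Zolotarev's optimal points come from the parametrisation \<open>t = \<theta>\<^sub>3(z) / \<theta>\<^sub>4(z)\<close>, up to scaling, with nome \<open>q\<close>: the cross ratio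
  \<open>(t(z) - t(w)) / (t(z) + t(w))\<close> is a product of quotients \<open>\<theta>\<^sub>1 / \<theta>\<^sub>4\<close> of nome \<open>q\<^sup>2\<close> at \<open>z + w\<close> and \<open>z - w\<close>, and by
  the triple product its product over equally spaced \<open>w\<close> is such a quotient of nome
  \<open>q\<^bsup>4l\<^esup>\<close>, giving \<open>|r| \<le> 2 q\<^sup>l\<close>. For \<open>q = exp (- h)\<close> and \<open>h = \<pi>\<^sup>2 / (2 ln (4 \<kappa>))\<close> the range of \<open>t\<close>
  covers \<open>[a, b]\<close>; this half of Jacobi's imaginary transformation is read off from partial
  fractions of the hyperbolic functions.\<close>

section \<open>Symmetric matrices and singular values\<close>

text \<open>The constants are forced as follows. Since \<kappa> may not involve the smallest
  eigenvalue of \<open>A + D\<close>, \<open>mat_sqrt (A + D)\<close> supplies only the lower bound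
  0, whereas \<open>mat_sqrt A\<close> is at least \<open>sqrt (lambda_min A)\<close>. Moving half
  of this gap from one coefficient to the other keeps the Sylvester equation and puts both spectra
  above the same positive number. The estimate must hold for every l, so asymptotics of Zolotarev
  numbers do not suffice: the bound 2 for the theta quotient is uniform in the nome, and its square
  is the 4 in front. The 4 inside the logarithm has another source. With M = theta_3(0) / theta_4(0)
  the parameter t covers intervals whose endpoints have ratio up to M^2, and M^2 is at least
  exp(pi^2 / (2 h)) / 4. As a one-sided estimate is enough, it is obtained from truncated series,
  each cut where the error has the favourable sign: nonnegative terms are dropped from below,
  alternating sums stop after an odd number of terms.\<close>

text \<open>Indexing by the coordinate type \<open>'n\<close> itself makes every such family a
  basis, so no spanning condition is stated.\<close>

definition onb :: "('n \<Rightarrow> real^'n) \<Rightarrow> bool" where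
  "onb v \<longleftrightarrow> (\<forall>i j. v i \<bullet> v j = (if i = j then 1 else 0))"

definition eigenbasis :: "real^'n^'n \<Rightarrow> ('n \<Rightarrow> real^'n) \<Rightarrow> ('n \<Rightarrow> real) \<Rightarrow> bool" where
  "eigenbasis M v e \<longleftrightarrow> onb v \<and> (\<forall>i. M *v v i = e i *\<^sub>R v i)"

lemma onb_inner: "onb v \<Longrightarrow> v i \<bullet> v j = (if i = j then 1 else 0)"
  by (simp add: onb_def)

lemma onb_expand:
  fixes v :: "'n \<Rightarrow> real^'n"
  assumes "onb v"
  shows "(\<Sum>i\<in>UNIV. (x \<bullet> v i) *\<^sub>R v i) = x"
proof -
  define V where "V = (\<chi> i j. v j $ i)"
  have "transpose V ** V = mat 1"
    using assms
    by (simp add: vec_eq_iff matrix_matrix_mult_def transpose_def V_def mat_def onb_def inner_vec_def)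
  then have "V ** transpose V = mat 1"
    by (simp add: matrix_left_right_inverse)
  then have "x = V *v (transpose V *v x)"
    by (simp only: matrix_vector_mul_assoc matrix_vector_mul_lid)
  also have "\<dots> = (\<Sum>i\<in>UNIV. (x \<bullet> v i) *\<^sub>R v i)"
    by (simp add: vec_eq_iff matrix_vector_mult_def transpose_def V_def inner_vec_def mult.commute)
  finally show ?thesis ..
qed

lemma onb_inner_expand:
  fixes v :: "'n \<Rightarrow> real^'n"
  assumes "onb v"
  shows "x \<bullet> y = (\<Sum>i\<in>UNIV. (x \<bullet> v i) * (y \<bullet> v i))"
proof -
  have "x \<bullet> y = (\<Sum>i\<in>UNIV. (x \<bullet> v i) *\<^sub>R v i) \<bullet> y"
    by (simp add: onb_expand[OF assms])
  also have "\<dots> = (\<Sum>i\<in>UNIV. (x \<bullet> v i) * (y \<bullet> v i))"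
    unfolding inner_sum_left by (simp add: inner_commute)
  finally show ?thesis .
qed

lemma onb_norm2:
  fixes v :: "'n \<Rightarrow> real^'n"
  assumes "onb v"
  shows "(norm x)\<^sup>2 = (\<Sum>i\<in>UNIV. (x \<bullet> v i)\<^sup>2)"
  using onb_inner_expand[OF assms, of x x] by (simp only: power2_norm_eq_inner) (simp only: power2_eq_square)

lemma onb_norm: "onb v \<Longrightarrow> norm (v i) = 1"
  by (simp add: norm_eq_sqrt_inner onb_inner)

lemma onb_mat_eqI:
  fixes v :: "'n \<Rightarrow> real^'n" and A B :: "real^'n^'n"
  assumes "onb v" and "\<And>i. A *v v i = B *v v i"
  shows "A = B"
proof -
  have "A *v x = B *v x" for x
  proof -
    have "A *v (\<Sum>i\<in>UNIV. (x \<bullet> v i) *\<^sub>R v i) = B *v (\<Sum>i\<in>UNIV. (x \<bullet> v i) *\<^sub>R v i)"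
      using assms(2) by (simp add: linear_sum[OF matrix_vector_mul_linear] matrix_vector_mult_scaleR)
    then show ?thesis by (simp add: onb_expand[OF assms(1)])
  qed
  then show ?thesis by (simp add: matrix_eq)
qed

section \<open>Spectral theorem for real symmetric matrices\<close>

lemma sym_mat_inner:
  assumes "sym_mat M" shows "(M *v x) \<bullet> y = x \<bullet> (M *v y)"
  using assms by (metis dot_lmul_matrix sym_mat_def transpose_matrix_vector inner_commute)

text \<open>A maximiser x of the quadratic form on the unit sphere of S is an eigenvector: the
  residual r = c x - M x lies in S by invariance, and moving x along r would violate maximality
  unless r vanishes.\<close>

lemma sym_mat_eigenvector_exists:
  fixes M :: "real^'n^'n"
  assumes M: "sym_mat M" and S: "subspace S" and inv: "\<And>x. x \<in> S \<Longrightarrow> M *v x \<in> S"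
    and ne: "y \<in> S" "y \<noteq> 0"
  shows "\<exists>x c. x \<in> S \<and> norm x = 1 \<and> M *v x = c *\<^sub>R x"
proof -
  let ?K = "S \<inter> sphere 0 1"
  have "compact ?K"
    using closed_subspace[OF S] by (simp add: closed_Int_compact)
  moreover have "(1 / norm y) *\<^sub>R y \<in> ?K"
    using ne S by (simp add: subspace_scale)
  then have "?K \<noteq> {}" by blast
  moreover have "continuous_on ?K (\<lambda>x. x \<bullet> (M *v x))"
    by (intro continuous_intros)
  ultimately obtain x where x: "x \<in> ?K" and max: "\<And>z. z \<in> ?K \<Longrightarrow> z \<bullet> (M *v z) \<le> x \<bullet> (M *v x)"
    using continuous_attains_sup by (metis (no_types, lifting))
  define c where "c = x \<bullet> (M *v x)"
  have psd: "z \<bullet> (M *v z) \<le> c * (z \<bullet> z)" if "z \<in> S" for z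
  proof (cases "z = 0")
    case False
    have "(1 / norm z) *\<^sub>R z \<in> ?K"
      using False that S by (simp add: subspace_scale)
    from max[OF this] have "(z \<bullet> (M *v z)) / (norm z)\<^sup>2 \<le> c"
      by (simp add: c_def matrix_vector_mult_scaleR power2_eq_square)
    then show ?thesis
      using False by (simp add: field_simps power2_norm_eq_inner)
  qed simp
  define r where "r = c *\<^sub>R x - M *v x"
  have xx: "x \<bullet> x = 1" and xS: "x \<in> S"
    using x by (auto simp: norm_eq_1)
  have rS: "r \<in> S"
    unfolding r_def using xS S inv by (intro subspace_diff subspace_scale) auto
  have "r \<bullet> r = 0"
  proof (rule ccontr)
    assume "r \<bullet> r \<noteq> 0"
    then have rr: "r \<bullet> r > 0" using inner_ge_zero[of r] by linarith
    define k where "k = c * (r \<bullet> r) - r \<bullet> (M *v r)"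
    have k: "k \<ge> 0" using psd[OF rS] by (simp add: k_def)
    \<comment> \<open>the form \<open>c |z|\<^sup>2 - z \<bullet> M z\<close> is nonnegative on \<open>S\<close> and vanishes at \<open>x\<close>, so its derivative in direction \<open>r\<close> vanishes\<close>
    have 1: "2 * t * (r \<bullet> r) + t\<^sup>2 * k \<ge> 0" for t
    proof -
      have "x + t *\<^sub>R r \<in> S" using xS rS S by (intro subspace_add subspace_scale)
      from psd[OF this]
      have *: "(x + t *\<^sub>R r) \<bullet> (M *v x + t *\<^sub>R (M *v r)) \<le> c * ((x + t *\<^sub>R r) \<bullet> (x + t *\<^sub>R r))"
        by (simp add: matrix_vector_right_distrib matrix_vector_mult_scaleR)
      have e1: "x \<bullet> (M *v r) = r \<bullet> (M *v x)"
        using sym_mat_inner[OF M, of x r] by (simp add: inner_commute)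
      have e2: "(x + t *\<^sub>R r) \<bullet> (M *v x + t *\<^sub>R (M *v r)) = c + 2 * t * (r \<bullet> (M *v x)) + t\<^sup>2 * (r \<bullet> (M *v r))"
        by (simp add: inner_add_left inner_add_right e1 c_def power2_eq_square algebra_simps)
      have e3: "(x + t *\<^sub>R r) \<bullet> (x + t *\<^sub>R r) = 1 + 2 * t * (r \<bullet> x) + t\<^sup>2 * (r \<bullet> r)"
        by (simp add: inner_add_left inner_add_right xx power2_eq_square algebra_simps inner_commute[of x r])
      have e4: "r \<bullet> r = c * (r \<bullet> x) - r \<bullet> (M *v x)"
        by (subst (2) r_def) (simp add: inner_diff_right)
      have "2 * t * (r \<bullet> r) + t\<^sup>2 * k = c * (1 + 2 * t * (r \<bullet> x) + t\<^sup>2 * (r \<bullet> r)) - (c + 2 * t * (r \<bullet> (M *v x)) + t\<^sup>2 * (r \<bullet> (M *v r)))"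
        by (subst (1) e4) (simp add: k_def algebra_simps)
      with * show ?thesis unfolding e2 e3 by simp
    qed
    \<comment> \<open>The value t = - (r . r) / (k + 1) makes the form in \<open>1\<close> negative.
      The summand 1 in the denominator covers the case k = 0.\<close>
    have "2 * (- (r \<bullet> r) / (k + 1)) * (r \<bullet> r) + (- (r \<bullet> r) / (k + 1))\<^sup>2 * k
          = - ((r \<bullet> r) / (k + 1))\<^sup>2 * (k + 2)"
    proof -
      have "2 * (- r' / k') * r' + (- r' / k')\<^sup>2 * (k' - 1) = - (r' / k')\<^sup>2 * (k' + 1)" if "k' > 0" for r' k' :: real
        using that by (simp add: divide_simps) (simp add: power2_eq_square algebra_simps)
      from this[of "k + 1" "r \<bullet> r"] k show ?thesis by (simp add: algebra_simps)
    qed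
    also have "\<dots> < 0"
      using rr k by (simp add: mult_pos_pos)
    finally show False using 1 by (meson not_le)
  qed
  then have "M *v x = c *\<^sub>R x" by (simp add: r_def)
  with x show ?thesis by auto
qed

text \<open>The orthogonal complement of the eigenvectors found so far is invariant because M is
  symmetric, and nonzero as long as fewer than \<open>CARD('n)\<close> are present, so it contains
  another one.\<close>

lemma sym_mat_orthonormal_eigenvectors:
  fixes M :: "real^'n^'n"
  assumes M: "sym_mat M" and "m \<le> CARD('n)"
  shows "\<exists>B. finite B \<and> card B = m \<and> (\<forall>x\<in>B. norm x = 1 \<and> (\<exists>c. M *v x = c *\<^sub>R x))
           \<and> (\<forall>x\<in>B. \<forall>y\<in>B. x \<noteq> y \<longrightarrow> x \<bullet> y = 0)"
  using assms(2)
proof (induction m)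
  case 0
  show ?case by (rule exI[of _ "{}"]) auto
next
  case (Suc m)
  then obtain B where B: "finite B" "card B = m" "\<forall>x\<in>B. norm x = 1 \<and> (\<exists>c. M *v x = c *\<^sub>R x)"
    "\<forall>x\<in>B. \<forall>y\<in>B. x \<noteq> y \<longrightarrow> x \<bullet> y = 0" by auto
  define S where "S = {x. \<forall>b\<in>B. b \<bullet> x = 0}"
  have S: "subspace S"
    by (auto simp: S_def subspace_def inner_add_right)
  have inv: "M *v x \<in> S" if "x \<in> S" for x
    unfolding S_def
  proof (intro CollectI ballI)
    fix b assume b: "b \<in> B"
    then obtain c where "M *v b = c *\<^sub>R b" using B by blast
    then show "b \<bullet> (M *v x) = 0"
      using that b sym_mat_inner[OF M, of b x] by (simp add: S_def)
  qed
  have "dim (span B) < DIM(real^'n)"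
    using B(1,2) Suc.prems dim_le_card'[of B] by simp
  then obtain y where "y \<noteq> 0" "\<And>b. b \<in> span B \<Longrightarrow> orthogonal y b"
    using orthogonal_to_subspace_exists[of B] by (metis dim_span)
  then have "y \<in> S" "y \<noteq> 0"
    by (auto simp: S_def orthogonal_def span_base inner_commute)
  from sym_mat_eigenvector_exists[OF M S inv this]
  obtain x c where x: "x \<in> S" "norm x = 1" "M *v x = c *\<^sub>R x" by blast
  have "x \<notin> B" using x(1,2) by (auto simp: S_def)
  then show ?case
    using B x by (intro exI[of _ "insert x B"]) (auto simp: S_def inner_commute)
qed

theorem sym_mat_eigenbasis_exists:
  fixes M :: "real^'n^'n"
  assumes "sym_mat M"
  obtains v e where "eigenbasis M v e"
proof -
  obtain B where B: "finite B" "card B = CARD('n)" "\<forall>x\<in>B. norm x = 1 \<and> (\<exists>c. M *v x = c *\<^sub>R x)"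
    "\<forall>x\<in>B. \<forall>y\<in>B. x \<noteq> y \<longrightarrow> x \<bullet> y = 0"
    using sym_mat_orthonormal_eigenvectors[OF assms order_refl] by blast
  obtain v where v: "bij_betw v (UNIV :: 'n set) B"
    using finite_same_card_bij[of "UNIV :: 'n set" B] B by auto
  then have vB: "v i \<in> B" for i by (auto simp: bij_betw_def)
  have "onb v"
    unfolding onb_def
  proof (intro allI)
    fix i j
    show "v i \<bullet> v j = (if i = j then 1 else 0)"
      using B(3,4) vB[of i] vB[of j] bij_betw_imp_inj_on[OF v]
      by (cases "i = j") (simp_all add: norm_eq_1 inj_eq)
  qed
  have "\<forall>i. \<exists>c. M *v v i = c *\<^sub>R v i"
    using B(3) vB by blast
  then obtain e where "\<forall>i. M *v v i = e i *\<^sub>R v i"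
    using choice[of "\<lambda>i c. M *v v i = c *\<^sub>R v i"] by blast
  with \<open>onb v\<close> have "eigenbasis M v e"
    by (simp add: eigenbasis_def)
  then show ?thesis by (rule that)
qed

lemma eigenbasis_onb: "eigenbasis M v e \<Longrightarrow> onb v"
  by (simp add: eigenbasis_def)

lemma eigenbasis_apply: "eigenbasis M v e \<Longrightarrow> M *v v i = e i *\<^sub>R v i"
  by (simp add: eigenbasis_def)

lemma eigenbasis_inner:
  assumes "eigenbasis M v e" "sym_mat M"
  shows "(M *v x) \<bullet> v i = e i * (x \<bullet> v i)"
  using sym_mat_inner[OF assms(2), of x "v i"] eigenbasis_apply[OF assms(1)] by simp

lemma eigenbasis_quadratic_form:
  assumes "eigenbasis M v e" "sym_mat M"
  shows "x \<bullet> (M *v x) = (\<Sum>i\<in>UNIV. e i * (x \<bullet> v i)\<^sup>2)"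
  by (subst onb_inner_expand[OF eigenbasis_onb[OF assms(1)]])
    (simp add: eigenbasis_inner[OF assms] power2_eq_square mult_ac)

text \<open>Bridge from the definitions, which read eigenvalues off the characteristic polynomial
  with multiplicity, to eigenbases. With V the matrix of eigenvectors as constant polynomials and E
  diagonal, (x I - M) V = V E; taking determinants and cancelling det V factors the polynomial into
  linear terms.\<close>

lemma proots_char_poly:
  fixes M :: "real^'n^'n"
  assumes "eigenbasis M v e"
  shows "proots (char_poly M) = image_mset e (mset_set UNIV)"
proof -
  note ob = eigenbasis_onb[OF assms]
  define V :: "(real poly)^'n^'n" where "V = (\<chi> i j. [:v j $ i:])"
  define X :: "(real poly)^'n^'n" where "X = (\<chi> i j. (if i = j then [:0, 1:] else 0) - [:M $ i $ j:])"
  define E :: "(real poly)^'n^'n" where "E = (\<chi> i j. if i = j then [:- e i, 1:] else 0)"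
  have const_sum: "(\<Sum>i\<in>S. [:f i:]) = [:\<Sum>i\<in>S. f i:]" for f :: "'n \<Rightarrow> real" and S
    by (induction S rule: infinite_finite_induct) auto
  have "transpose V ** V = mat 1"
  proof -
    have "(\<Sum>k\<in>UNIV. [:v i $ k:] * [:v j $ k:]) = [:v i \<bullet> v j:]" for i j
      by (simp add: const_sum inner_vec_def mult.commute)
    then show ?thesis
      unfolding vec_eq_iff matrix_matrix_mult_def transpose_def V_def mat_def
      by (simp only: vec_lambda_beta onb_inner[OF ob]) (simp add: one_pCons)
  qed
  then have "det (transpose V) * det V = 1"
    by (simp only: det_mul[symmetric] det_I)
  then have V0: "det V \<noteq> 0" by (metis mult_zero_right zero_neq_one)
  have "X ** V = V ** E"
    unfolding vec_eq_iff
  proof (intro allI)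
    fix i j
    have Mv: "(\<Sum>k\<in>UNIV. M $ i $ k * v j $ k) = e j * v j $ i"
      using arg_cong[OF eigenbasis_apply[OF assms, of j], of "\<lambda>x. x $ i"]
      by (simp add: matrix_vector_mult_def)
    have "(X ** V) $ i $ j = (\<Sum>k\<in>UNIV. ((if i = k then [:0, 1:] else 0) - [:M $ i $ k:]) * [:v j $ k:])"
      by (simp add: matrix_matrix_mult_def X_def V_def)
    also have "\<dots> = (\<Sum>k\<in>UNIV. (if i = k then [:0, 1:] * [:v j $ k:] else 0) - [:M $ i $ k * v j $ k:])"
      by (intro sum.cong) (auto simp: algebra_simps)
    also have "\<dots> = [:0, 1:] * [:v j $ i:] - [:e j * v j $ i:]"
      by (simp only: sum_subtractf const_sum Mv sum.delta'[OF finite] UNIV_I if_True)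
    also have "\<dots> = (\<Sum>k\<in>UNIV. if k = j then [:v j $ i:] * [:- e j, 1:] else 0)"
      by (simp only: sum.delta[OF finite] UNIV_I if_True) (simp add: mult.commute)
    also have "\<dots> = (\<Sum>k\<in>UNIV. [:v k $ i:] * (if k = j then [:- e k, 1:] else 0))"
    proof (rule sum.cong[OF refl])
      fix k
      show "(if k = j then [:v j $ i:] * [:- e j, 1:] else 0) = [:v k $ i:] * (if k = j then [:- e k, 1:] else 0)"
        by (cases "k = j") (simp_all only: if_True if_False mult_zero_right simp_thms)
    qed
    also have "\<dots> = (V ** E) $ i $ j"
      by (simp only: matrix_matrix_mult_def E_def V_def vec_lambda_beta)
    finally show "(X ** V) $ i $ j = (V ** E) $ i $ j" .
  qed
  then have "det X * det V = det V * det E"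
    by (simp only: det_mul[symmetric])
  with V0 have "det X = det E" by simp
  also have "det E = (\<Prod>i\<in>UNIV. [:- e i, 1:])"
    by (subst det_diagonal) (auto simp: E_def)
  finally have "char_poly M = (\<Prod>i\<in>UNIV. [:- e i, 1:])"
    by (simp add: char_poly_def X_def)
  also have "proots \<dots> = (\<Sum>i\<in>UNIV. {#e i#})"
    by (subst proots_prod) (simp_all only: proots_linear_factor minus_minus, simp)
  also have "\<dots> = image_mset e (mset_set UNIV)"
    by (simp add: sum_unfold_sum_mset)
  finally show ?thesis .
qed

text \<open>The functional calculus, sum of f_k v_k v_k^T. Square roots and rational functions of a
  matrix become scalar functions of its eigenvalues, without any matrix inverse.\<close>

definition matfun :: "('n \<Rightarrow> real^'n) \<Rightarrow> ('n \<Rightarrow> real) \<Rightarrow> real^'n^'n" where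
  "matfun v f = (\<chi> i j. \<Sum>k\<in>UNIV. f k * (v k $ i * v k $ j))"

lemma matfun_mult_vec: "matfun v f *v x = (\<Sum>k\<in>UNIV. (f k * (x \<bullet> v k)) *\<^sub>R v k)"
proof -
  have "(matfun v f *v x) $ i = (\<Sum>k\<in>UNIV. (f k * (x \<bullet> v k)) *\<^sub>R v k) $ i" for i
  proof -
    have "(matfun v f *v x) $ i = (\<Sum>j\<in>UNIV. \<Sum>k\<in>UNIV. f k * (v k $ i * v k $ j) * x $ j)"
      by (simp add: matfun_def matrix_vector_mult_def sum_distrib_right)
    also have "\<dots> = (\<Sum>k\<in>UNIV. \<Sum>j\<in>UNIV. f k * (v k $ i * v k $ j) * x $ j)"
      by (rule sum.swap)
    also have "\<dots> = (\<Sum>k\<in>UNIV. f k * (\<Sum>j\<in>UNIV. x $ j * v k $ j) * v k $ i)"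
      by (simp add: sum_distrib_left sum_distrib_right mult_ac)
    finally show ?thesis by (simp add: inner_vec_def)
  qed
  then show ?thesis by (simp add: vec_eq_iff)
qed

lemma sym_mat_matfun: "sym_mat (matfun v f)"
  by (simp add: sym_mat_def matfun_def transpose_def vec_eq_iff mult_ac)

lemma eigenbasis_matfun:
  assumes "onb v"
  shows "eigenbasis (matfun v f) v f"
proof -
  have "matfun v f *v v i = f i *\<^sub>R v i" for i
  proof -
    have "matfun v f *v v i = (\<Sum>k\<in>UNIV. if k = i then f i *\<^sub>R v i else 0)"
      unfolding matfun_mult_vec by (intro sum.cong) (auto simp: onb_inner[OF assms])
    then show ?thesis by simp
  qed
  with assms show ?thesis by (simp add: eigenbasis_def)
qed

lemma matfun_mult:
  assumes "onb v"
  shows "matfun v f ** matfun v g = matfun v (\<lambda>i. f i * g i)"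
  by (rule onb_mat_eqI[OF assms])
    (simp add: matrix_vector_mul_assoc[symmetric] eigenbasis_apply[OF eigenbasis_matfun[OF assms]]
      matrix_vector_mult_scaleR mult.commute)

lemma matfun_one:
  assumes "onb v"
  shows "matfun v (\<lambda>_. 1) = mat 1"
  by (rule onb_mat_eqI[OF assms]) (simp add: eigenbasis_apply[OF eigenbasis_matfun[OF assms]])

lemma eigenbasis_eq_matfun:
  assumes "eigenbasis M v e"
  shows "M = matfun v e"
  by (rule onb_mat_eqI[OF eigenbasis_onb[OF assms]])
    (simp add: eigenbasis_apply[OF assms] eigenbasis_apply[OF eigenbasis_matfun[OF eigenbasis_onb[OF assms]]])

lemma norm_matfun_le:
  assumes "onb v" and "\<And>i. \<bar>f i\<bar> \<le> c"
  shows "norm (matfun v f *v x) \<le> c * norm x"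
proof -
  have c: "c \<ge> 0" using assms(2)[of undefined] by linarith
  have "(norm (matfun v f *v x))\<^sup>2 = (\<Sum>i\<in>UNIV. (f i)\<^sup>2 * (x \<bullet> v i)\<^sup>2)"
    unfolding onb_norm2[OF assms(1)]
    by (simp add: eigenbasis_inner[OF eigenbasis_matfun[OF assms(1)] sym_mat_matfun] power_mult_distrib)
  also have "\<dots> \<le> (\<Sum>i\<in>UNIV. c\<^sup>2 * (x \<bullet> v i)\<^sup>2)"
    using assms(2) by (intro sum_mono mult_right_mono) (auto simp: abs_le_square_iff[symmetric] c)
  also have "\<dots> = (c * norm x)\<^sup>2"
    by (simp add: onb_norm2[OF assms(1), of x] power_mult_distrib sum_distrib_left)
  finally show ?thesis
    by (rule power2_le_imp_le) (use c in simp)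
qed

section \<open>Principal square roots\<close>

lemma pos_semidef_eigenvalue_nonneg:
  assumes "pos_semidef M" "eigenbasis M v e"
  shows "e i \<ge> 0"
proof -
  have "v i \<bullet> (M *v v i) \<ge> 0" using assms(1) by (simp add: pos_semidef_def)
  then show ?thesis
    using onb_inner[OF eigenbasis_onb[OF assms(2)], of i i] by (simp add: eigenbasis_apply[OF assms(2)])
qed

text \<open>Let v be an eigenvector of S for e. Then (T + e)(T - e) v = 0, so u = (T - e) v
  satisfies T u = - e u, which contradicts T being semidefinite if e > 0 and u is nonzero. If e = 0,
  then |T v|^2 = v . T T v = 0.\<close>

lemma pos_semidef_sqrt_unique:
  fixes S T :: "real^'n^'n"
  assumes S: "pos_semidef S" and T: "pos_semidef T" and eq: "S ** S = T ** T"
  shows "S = T"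
proof -
  obtain v e where ve: "eigenbasis S v e"
    using S sym_mat_eigenbasis_exists pos_semidef_def by blast
  have sT: "sym_mat T" using T by (simp add: pos_semidef_def)
  have "S *v v i = T *v v i" for i
  proof -
    have "T *v (T *v v i) = S *v (S *v v i)"
      by (simp add: matrix_vector_mul_assoc eq)
    also have "\<dots> = (e i * e i) *\<^sub>R v i"
      by (simp add: eigenbasis_apply[OF ve] matrix_vector_mult_scaleR)
    finally have TT: "T *v (T *v v i) = (e i * e i) *\<^sub>R v i" .
    define u where "u = T *v v i - e i *\<^sub>R v i"
    have Tu: "T *v u = - e i *\<^sub>R u"
      by (simp add: u_def matrix_vector_mult_diff_distrib matrix_vector_mult_scaleR TT scaleR_diff_right)
    have ei: "e i \<ge> 0" using pos_semidef_eigenvalue_nonneg[OF S ve] .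
    have "u = 0"
    proof (cases "e i = 0")
      case True
      have "u \<bullet> u = 0"
        using True TT sym_mat_inner[OF sT, of "v i" "T *v v i"] by (simp add: u_def)
      then show ?thesis by simp
    next
      case False
      have "0 \<le> u \<bullet> (T *v u)" using T by (simp add: pos_semidef_def)
      also have "\<dots> = - (e i * (u \<bullet> u))" by (simp add: Tu)
      finally have "u \<bullet> u \<le> 0" using False ei by (simp add: mult_le_0_iff)
      then show ?thesis using inner_ge_zero[of u] by (simp add: order_antisym_conv)
    qed
    then show ?thesis by (simp add: u_def eigenbasis_apply[OF ve])
  qed
  then show ?thesis by (rule onb_mat_eqI[OF eigenbasis_onb[OF ve]])
qed

lemma pos_semidef_matfun:
  assumes "onb v" "\<And>i. f i \<ge> 0"
  shows "pos_semidef (matfun v f)"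
  using assms
  by (simp add: pos_semidef_def sym_mat_matfun sum_nonneg
      eigenbasis_quadratic_form[OF eigenbasis_matfun[OF assms(1)] sym_mat_matfun])

lemma pos_def_imp_pos_semidef: "pos_def M \<Longrightarrow> pos_semidef M"
  unfolding pos_def_def pos_semidef_def by (metis inner_zero_left less_imp_le order_refl)

lemma mat_sqrt:
  fixes M :: "real^'n^'n"
  assumes "pos_semidef M"
  shows "pos_semidef (mat_sqrt M)" "mat_sqrt M ** mat_sqrt M = M"
proof -
  obtain v e where ve: "eigenbasis M v e"
    using assms sym_mat_eigenbasis_exists pos_semidef_def by blast
  have e: "e i \<ge> 0" for i by (rule pos_semidef_eigenvalue_nonneg[OF assms ve])
  note ob = eigenbasis_onb[OF ve]
  let ?S = "matfun v (\<lambda>i. sqrt (e i))"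
  have "?S ** ?S = matfun v (\<lambda>i. e i)"
    unfolding matfun_mult[OF ob] using e by simp
  also have "\<dots> = M" using eigenbasis_eq_matfun[OF ve] by simp
  finally have "pos_semidef ?S \<and> ?S ** ?S = M"
    using e by (simp add: pos_semidef_matfun[OF ob])
  then have "pos_semidef (mat_sqrt M) \<and> mat_sqrt M ** mat_sqrt M = M"
    unfolding mat_sqrt_def by (rule theI) (metis \<open>pos_semidef ?S \<and> ?S ** ?S = M\<close> pos_semidef_sqrt_unique)
  then show "pos_semidef (mat_sqrt M)" "mat_sqrt M ** mat_sqrt M = M" by auto
qed

section \<open>Spectral bounds through \<open>lambda_min\<close> and \<open>norm2\<close>\<close>

lemma lambda_min_le:
  assumes "eigenbasis M v e" shows "lambda_min M \<le> e i"
  unfolding lambda_min_def proots_char_poly[OF assms] by simp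

lemma lambda_min_mem:
  assumes "eigenbasis M v e" shows "lambda_min M \<in> range e"
proof -
  have "lambda_min M = Min (range e)"
    by (simp add: lambda_min_def proots_char_poly[OF assms])
  then show ?thesis by (simp add: Min_in)
qed

lemma lambda_min_pos:
  assumes "pos_def M" shows "lambda_min M > 0"
proof -
  obtain v e where ve: "eigenbasis M v e"
    using assms sym_mat_eigenbasis_exists pos_def_def by blast
  obtain i where i: "lambda_min M = e i" using lambda_min_mem[OF ve] by blast
  have "v i \<noteq> 0" using onb_norm[OF eigenbasis_onb[OF ve], of i] by auto
  then have "v i \<bullet> (M *v v i) > 0" using assms by (simp add: pos_def_def)
  then show ?thesis
    using onb_inner[OF eigenbasis_onb[OF ve], of i i] i by (simp add: eigenbasis_apply[OF ve])
qed

lemma lambda_min_quadratic_form: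
  assumes "sym_mat M"
  shows "lambda_min M * (norm x)\<^sup>2 \<le> x \<bullet> (M *v x)"
proof -
  obtain v e where ve: "eigenbasis M v e"
    using assms sym_mat_eigenbasis_exists by blast
  show ?thesis
    unfolding eigenbasis_quadratic_form[OF ve assms] onb_norm2[OF eigenbasis_onb[OF ve], of x] sum_distrib_left
    by (intro sum_mono mult_right_mono lambda_min_le[OF ve]) simp
qed

lemma norm2_bound: "norm (M *v x) \<le> norm2 M * norm x"
  unfolding norm2_def by (rule onorm[OF matrix_vector_mul_bounded_linear])

lemma norm2_nonneg: "norm2 M \<ge> 0"
  unfolding norm2_def by (rule onorm_pos_le[OF matrix_vector_mul_bounded_linear])

lemma norm2_add: "norm2 (A + D) \<le> norm2 A + norm2 D"
  unfolding norm2_def matrix_vector_mult_add_rdistrib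
  by (rule onorm_triangle[OF matrix_vector_mul_bounded_linear matrix_vector_mul_bounded_linear])

lemma mat_sqrt_eigenvalue:
  assumes "pos_semidef M" "eigenbasis (mat_sqrt M) v e"
  shows "M *v v i = (e i)\<^sup>2 *\<^sub>R v i"
  using matrix_vector_mul_assoc[of "mat_sqrt M" "mat_sqrt M" "v i"]
  by (simp add: mat_sqrt(2)[OF assms(1)] eigenbasis_apply[OF assms(2)] matrix_vector_mult_scaleR power2_eq_square)

lemma mat_sqrt_eigenvalue_bounds:
  assumes "pos_semidef M" "eigenbasis (mat_sqrt M) v e"
  shows "e i \<ge> 0" "e i \<le> sqrt (norm2 M)" "sqrt (lambda_min M) \<le> e i"
proof -
  show e: "e i \<ge> 0"
    by (rule pos_semidef_eigenvalue_nonneg[OF mat_sqrt(1)[OF assms(1)] assms(2)])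
  note Mv = mat_sqrt_eigenvalue[OF assms, of i] and vi = onb_norm[OF eigenbasis_onb[OF assms(2)], of i]
  have "(e i)\<^sup>2 \<le> norm2 M"
    using norm2_bound[of M "v i"] by (simp add: Mv vi)
  then show "e i \<le> sqrt (norm2 M)" by (rule real_le_rsqrt)
  have "lambda_min M \<le> (e i)\<^sup>2"
    using lambda_min_quadratic_form[of M "v i"] assms(1) vi
    by (simp add: Mv pos_semidef_def norm_eq_1)
  then show "sqrt (lambda_min M) \<le> e i"
    using e by (simp add: real_le_lsqrt)
qed

section \<open>Courant-Fischer characterisation of singular values\<close>

lemma dim_Un_le: "dim (A \<union> B) \<le> dim A + dim (B :: 'a::euclidean_space set)"
proof -
  have "dim (A \<union> B) = dim {x + y |x y. x \<in> span A \<and> y \<in> span B}"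
    by (simp only: span_Un[symmetric] dim_span)
  also have "\<dots> \<le> dim (span A) + dim (span B)"
    using dim_sums_Int[of "span A" "span B"] by simp
  finally show ?thesis by simp
qed

text \<open>\<open>gain X m c\<close>: off a subspace of codimension at most \<open>m\<close>, the operator norm of \<open>X\<close> is at most \<open>c\<close>;
  this is the Courant--Fischer description of \<open>\<sigma>\<^bsub>m+1\<^esub>(X) \<le> c\<close>.\<close>

definition gain :: "real^'n^'n \<Rightarrow> nat \<Rightarrow> real \<Rightarrow> bool" where
  "gain X m c \<longleftrightarrow> (\<exists>U. dim U \<le> m \<and> (\<forall>w. (\<forall>u\<in>U. u \<bullet> w = 0) \<longrightarrow> norm (X *v w) \<le> c * norm w))"

text \<open>The only facts about the sorted list that the min-max arguments use. The position m is
  zero-based, hence at most m eigenvalues are strictly larger than entry m and at least m + 1 are no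
  smaller.\<close>

lemma eigenvalues_desc_nth:
  fixes M :: "real^'n^'n"
  assumes "eigenbasis M v e" "m < CARD('n)"
  shows "card {i. e i > eigenvalues_desc M ! m} \<le> m"
    and "card {i. e i \<ge> eigenvalues_desc M ! m} > m"
    and "eigenvalues_desc M ! m \<in> range e"
proof -
  define xs where "xs = eigenvalues_desc M"
  have mset: "mset xs = image_mset e (mset_set UNIV)"
    by (simp add: xs_def eigenvalues_desc_def proots_char_poly[OF assms(1)])
  have len: "length xs = CARD('n)"
    using arg_cong[OF mset, of size] by simp
  have sorted: "sorted_wrt (\<ge>) xs"
    by (simp add: xs_def eigenvalues_desc_def sorted_wrt_rev)
  then have desc: "xs ! k' \<le> xs ! k" if "k \<le> k'" "k' < CARD('n)" for k k'
    using that len by (cases "k = k'") (auto simp: sorted_wrt_iff_nth_less)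
  have card: "card {i. P (e i)} = card {k. k < CARD('n) \<and> P (xs ! k)}" for P
  proof -
    have "card {i. P (e i)} = size (filter_mset P (mset xs))"
      unfolding mset by (simp add: filter_mset_image_mset filter_mset_mset_set)
    also have "\<dots> = length (filter P xs)" by (metis mset_filter size_mset)
    finally show ?thesis by (simp add: length_filter_conv_card len)
  qed
  have "{k. k < CARD('n) \<and> xs ! k > xs ! m} \<subseteq> {..<m}"
  proof
    fix k assume "k \<in> {k. k < CARD('n) \<and> xs ! k > xs ! m}"
    then have "\<not> m \<le> k" using desc[of m k] by auto
    then show "k \<in> {..<m}" by simp
  qed
  from card_mono[OF _ this] show "card {i. e i > eigenvalues_desc M ! m} \<le> m"
    using card[of "\<lambda>x. x > xs ! m"] by (simp add: xs_def)
  have "{..m} \<subseteq> {k. k < CARD('n) \<and> xs ! k \<ge> xs ! m}"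
    using desc assms(2) by auto
  from card_mono[OF _ this] show "card {i. e i \<ge> eigenvalues_desc M ! m} > m"
    using card[of "\<lambda>x. x \<ge> xs ! m"] by (simp add: xs_def)
  have "xs ! m \<in> set_mset (mset xs)" using assms(2) len by simp
  then show "eigenvalues_desc M ! m \<in> range e" unfolding mset by (simp add: xs_def)
qed

lemma inner_matrix_vector_mult: "u \<bullet> (Q *v w) = (transpose Q *v u) \<bullet> w" for Q :: "real^'n^'m"
  by (simp add: dot_lmul_matrix transpose_matrix_vector)

lemma gram_inner: "w \<bullet> ((transpose X ** X) *v w) = (norm (X *v w))\<^sup>2" for X :: "real^'n^'m"
proof -
  have "(norm (X *v w))\<^sup>2 = (X *v w) \<bullet> (X *v w)" by (rule power2_norm_eq_inner)
  also have "\<dots> = (transpose X *v (X *v w)) \<bullet> w" by (rule inner_matrix_vector_mult)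
  finally show ?thesis by (simp only: matrix_vector_mul_assoc inner_commute)
qed

context
  fixes X :: "real^'n^'n" and v e
  assumes ve: "eigenbasis (transpose X ** X) v e"
begin

lemma sym_mat_gram: "sym_mat (transpose X ** X)"
  by (simp add: sym_mat_def matrix_transpose_mul)

lemma gram_norm: "(norm (X *v w))\<^sup>2 = (\<Sum>i\<in>UNIV. e i * (w \<bullet> v i)\<^sup>2)"
proof -
  have "(norm (X *v w))\<^sup>2 = w \<bullet> ((transpose X ** X) *v w)"
    by (rule gram_inner[symmetric])
  also have "\<dots> = (\<Sum>i\<in>UNIV. e i * (w \<bullet> v i)\<^sup>2)"
    by (rule eigenbasis_quadratic_form[OF ve sym_mat_gram])
  finally show ?thesis .
qed

lemma gram_eigenvalue_nonneg: "e i \<ge> 0"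
proof -
  have "v i \<bullet> ((transpose X ** X) *v v i) = (norm (X *v v i))\<^sup>2"
    by (rule gram_inner)
  then have "e i = (norm (X *v v i))\<^sup>2"
    using onb_inner[OF eigenbasis_onb[OF ve], of i i] by (simp only: eigenbasis_apply[OF ve]) simp
  then show ?thesis by simp
qed

text \<open>The excluded subspace is spanned by the eigenvectors of the Gram matrix whose
  eigenvalues exceed the squared singular value; on its complement every remaining eigenvalue is
  small enough.\<close>

lemma gain_sing_val_aux:
  assumes "m < CARD('n)"
  shows "gain X m (sing_val X (Suc m))"
proof -
  note ob = eigenbasis_onb[OF ve]
  let ?c = "eigenvalues_desc (transpose X ** X) ! m"
  let ?I = "{i. e i > ?c}"
  have c: "?c \<ge> 0" using eigenvalues_desc_nth(3)[OF ve assms] gram_eigenvalue_nonneg by auto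
  have "dim (v ` ?I) \<le> card (v ` ?I)" by (rule dim_le_card'[OF finite_imageI]) simp
  also have "\<dots> \<le> card ?I" by (rule card_image_le) simp
  also have "\<dots> \<le> m" by (rule eigenvalues_desc_nth(1)[OF ve assms])
  finally have 1: "dim (v ` ?I) \<le> m" .
  have "norm (X *v w) \<le> sqrt ?c * norm w" if w: "\<forall>u\<in>v ` ?I. u \<bullet> w = 0" for w
  proof -
    have "(norm (X *v w))\<^sup>2 \<le> (\<Sum>i\<in>UNIV. ?c * (w \<bullet> v i)\<^sup>2)"
      unfolding gram_norm
    proof (rule sum_mono)
      fix i
      show "e i * (w \<bullet> v i)\<^sup>2 \<le> ?c * (w \<bullet> v i)\<^sup>2"
        using w by (cases "e i > ?c") (auto simp: inner_commute intro: mult_right_mono)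
    qed
    also have "\<dots> = (sqrt ?c * norm w)\<^sup>2"
      using c by (simp add: onb_norm2[OF ob, of w] power_mult_distrib sum_distrib_left)
    finally show ?thesis by (rule power2_le_imp_le) (use c in simp)
  qed
  with 1 show ?thesis
    unfolding gain_def sing_val_def by auto
qed

text \<open>U and the eigenvectors with eigenvalue below the squared singular value together span
  less than the whole space. A nonzero w orthogonal to all of them is stretched by at least the
  singular value and by at most c.\<close>

lemma sing_val_le_gain_aux:
  assumes "m < CARD('n)" and g: "gain X m c"
  shows "sing_val X (Suc m) \<le> c"
proof -
  note ob = eigenbasis_onb[OF ve]
  let ?c = "eigenvalues_desc (transpose X ** X) ! m"
  let ?I = "{i. e i \<ge> ?c}"
  have c: "?c \<ge> 0" using eigenvalues_desc_nth(3)[OF ve assms(1)] gram_eigenvalue_nonneg by auto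
  obtain U where U: "dim U \<le> m" "\<And>w. (\<forall>u\<in>U. u \<bullet> w = 0) \<Longrightarrow> norm (X *v w) \<le> c * norm w"
    using g unfolding gain_def by blast
  have "card ?I > m" by (rule eigenvalues_desc_nth(2)[OF ve assms(1)])
  moreover have "dim (v ` (- ?I)) \<le> card (- ?I)"
    by (meson card_image_le dim_le_card' finite finite_imageI order_trans)
  moreover have "card (- ?I) = CARD('n) - card ?I" by (simp add: Compl_eq_Diff_UNIV card_Diff_subset)
  moreover have "card ?I \<le> CARD('n)" by (simp add: card_mono)
  ultimately have "dim (U \<union> v ` (- ?I)) < DIM(real^'n)"
    using dim_Un_le[of U "v ` (- ?I)"] U(1) by simp
  then obtain w where w: "w \<noteq> 0" "\<And>y. y \<in> span (U \<union> v ` (- ?I)) \<Longrightarrow> orthogonal w y"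
    by (rule orthogonal_to_subspace_exists) blast
  have wv: "w \<bullet> v i = 0" if "i \<notin> ?I" for i
    using that w(2)[of "v i"] by (auto simp: orthogonal_def span_base)
  have "\<forall>u\<in>U. u \<bullet> w = 0"
    using w(2) by (auto simp: orthogonal_def span_base inner_commute)
  then have wc: "norm (X *v w) \<le> c * norm w" by (rule U(2))
  have "(sqrt ?c * norm w)\<^sup>2 = (\<Sum>i\<in>UNIV. ?c * (w \<bullet> v i)\<^sup>2)"
    using c by (simp add: onb_norm2[OF ob, of w] power_mult_distrib sum_distrib_left)
  also have "\<dots> \<le> (norm (X *v w))\<^sup>2"
    unfolding gram_norm
  proof (rule sum_mono)
    fix i
    show "?c * (w \<bullet> v i)\<^sup>2 \<le> e i * (w \<bullet> v i)\<^sup>2"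
      using wv[of i] by (cases "e i \<ge> ?c") (auto intro: mult_right_mono)
  qed
  finally have "sqrt ?c * norm w \<le> norm (X *v w)"
    by (rule power2_le_imp_le) simp
  with wc have "sqrt ?c * norm w \<le> c * norm w" by linarith
  then show ?thesis using w(1) by (simp add: sing_val_def)
qed

lemma sing_val_nonneg_aux: "m < CARD('n) \<Longrightarrow> sing_val X (Suc m) \<ge> 0"
  using eigenvalues_desc_nth(3)[OF ve, of m] gram_eigenvalue_nonneg by (auto simp: sing_val_def)

end

lemma gram_eigenbasis:
  obtains v e where "eigenbasis (transpose X ** X) v e"
  using sym_mat_eigenbasis_exists[of "transpose X ** X"] by (auto simp: sym_mat_def matrix_transpose_mul)

lemma gain_sing_val:
  fixes X :: "real^'n^'n"
  shows "m < CARD('n) \<Longrightarrow> gain X m (sing_val X (Suc m))"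
  by (rule gram_eigenbasis[of X]) (rule gain_sing_val_aux)

lemma sing_val_le_gain:
  fixes X :: "real^'n^'n"
  shows "m < CARD('n) \<Longrightarrow> gain X m c \<Longrightarrow> sing_val X (Suc m) \<le> c"
  by (rule gram_eigenbasis[of X]) (rule sing_val_le_gain_aux)

lemma sing_val_nonneg:
  fixes X :: "real^'n^'n"
  shows "m < CARD('n) \<Longrightarrow> sing_val X (Suc m) \<ge> 0"
  by (rule gram_eigenbasis[of X]) (rule sing_val_nonneg_aux)

text \<open>States that the rank is at most m, in the shape of \<open>gain\<close>: a subspace of
  dimension m whose orthogonal complement is killed. Such witnesses for sums and perturbations are
  combined by unions.\<close>

definition rank_bound :: "real^'n^'n \<Rightarrow> nat \<Rightarrow> bool" where
  "rank_bound Y m \<longleftrightarrow> (\<exists>U. dim U \<le> m \<and> (\<forall>w. (\<forall>u\<in>U. u \<bullet> w = 0) \<longrightarrow> Y *v w = 0))"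

lemma rank_bound_rank: "rank_bound Y (rank Y)"
proof -
  have "Y *v w = 0" if "\<forall>u\<in>rows Y. u \<bullet> w = 0" for w
    using that by (auto simp: vec_eq_iff matrix_vector_mul_component rows_def row_def)
  then show ?thesis
    unfolding rank_bound_def row_rank_def by blast
qed

lemma rank_bound_0: "rank_bound 0 0"
  unfolding rank_bound_def by (intro exI[of _ "{}"]) simp

lemma rank_bound_add:
  assumes "rank_bound Y m" "rank_bound Z k"
  shows "rank_bound (Y + Z) (m + k)"
proof -
  obtain U where U: "dim U \<le> m" "\<And>w. (\<forall>u\<in>U. u \<bullet> w = 0) \<Longrightarrow> Y *v w = 0"
    using assms(1) unfolding rank_bound_def by blast
  obtain V where V: "dim V \<le> k" "\<And>w. (\<forall>u\<in>V. u \<bullet> w = 0) \<Longrightarrow> Z *v w = 0"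
    using assms(2) unfolding rank_bound_def by blast
  show ?thesis
    unfolding rank_bound_def
    using U V dim_Un_le[of U V]
    by (intro exI[of _ "U \<union> V"]) (auto simp: matrix_vector_mult_add_rdistrib)
qed

lemma rank_bound_mult:
  assumes "rank_bound Y m"
  shows "rank_bound (P ** Y ** Q) m"
proof -
  obtain U where U: "dim U \<le> m" "\<And>w. (\<forall>u\<in>U. u \<bullet> w = 0) \<Longrightarrow> Y *v w = 0"
    using assms unfolding rank_bound_def by blast
  have "dim ((*v) (transpose Q) ` U) \<le> m"
    using dim_image_le[OF matrix_vector_mul_linear, of "transpose Q" U] U(1) by linarith
  moreover have "(P ** Y ** Q) *v w = 0" if "\<forall>u\<in>(*v) (transpose Q) ` U. u \<bullet> w = 0" for w
  proof -
    have "Y *v (Q *v w) = 0"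
      using that by (intro U(2)) (simp only: inner_matrix_vector_mult, blast)
    then show ?thesis by (simp add: matrix_vector_mul_assoc[symmetric])
  qed
  ultimately show ?thesis unfolding rank_bound_def by blast
qed

text \<open>Orthogonal to V, X w equals P X Q w. The bound for X applies to Q w if Q w is orthogonal
  to U, that is, if w is orthogonal to the image of U under \<open>transpose Q\<close>, whose
  dimension is no larger. So codimensions add while the factors multiply.\<close>

lemma gain_perturb:
  assumes g: "gain X m c" and E: "rank_bound (X - P ** X ** Q) k"
    and P: "\<And>x. norm (P *v x) \<le> a * norm x" and Q: "\<And>x. norm (Q *v x) \<le> b * norm x"
    and "a \<ge> 0" "c \<ge> 0"
  shows "gain X (m + k) (a * b * c)"
proof -
  obtain U where U: "dim U \<le> m" "\<And>w. (\<forall>u\<in>U. u \<bullet> w = 0) \<Longrightarrow> norm (X *v w) \<le> c * norm w"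
    using g unfolding gain_def by blast
  obtain V where V: "dim V \<le> k" "\<And>w. (\<forall>u\<in>V. u \<bullet> w = 0) \<Longrightarrow> (X - P ** X ** Q) *v w = 0"
    using E unfolding rank_bound_def by blast
  let ?W = "(*v) (transpose Q) ` U \<union> V"
  have "dim ((*v) (transpose Q) ` U) \<le> m"
    using dim_image_le[OF matrix_vector_mul_linear, of "transpose Q" U] U(1) by linarith
  then have "dim ?W \<le> m + k"
    using V(1) dim_Un_le[of "(*v) (transpose Q) ` U" V] by linarith
  moreover have "norm (X *v w) \<le> a * b * c * norm w" if w: "\<forall>u\<in>?W. u \<bullet> w = 0" for w
  proof -
    have "(X - P ** X ** Q) *v w = 0" using w by (intro V(2)) blast
    then have "X *v w = P *v (X *v (Q *v w))"
      by (simp add: matrix_vector_mult_diff_rdistrib matrix_vector_mul_assoc matrix_mul_assoc)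
    then have "norm (X *v w) \<le> a * norm (X *v (Q *v w))" by (simp add: P)
    also have "\<dots> \<le> a * (c * norm (Q *v w))"
      using w \<open>a \<ge> 0\<close>
      by (intro mult_left_mono U(2)) (simp_all only: inner_matrix_vector_mult, blast)
    also have "\<dots> \<le> a * (c * (b * norm w))"
      using Q \<open>c \<ge> 0\<close> \<open>a \<ge> 0\<close> by (intro mult_left_mono) auto
    finally show ?thesis by (simp add: mult_ac)
  qed
  ultimately show ?thesis unfolding gain_def by blast
qed

section \<open>The triple product and quadratic theta relations\<close>

text \<open>Gaussian binomial coefficients, defined by a Pascal rule rather than as quotients, so
  that the q-binomial theorem is an induction valid in any field and for every q.\<close>

fun qbinom :: "'a::field \<Rightarrow> nat \<Rightarrow> nat \<Rightarrow> 'a" where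
  "qbinom q n 0 = 1"
| "qbinom q 0 (Suc i) = 0"
| "qbinom q (Suc n) (Suc i) = qbinom q n (Suc i) + q ^ (n - i) * qbinom q n i"

definition qpoch :: "'a::field \<Rightarrow> nat \<Rightarrow> 'a" where
  "qpoch q n = (\<Prod>m<n. 1 - q ^ Suc m)"

lemma qbinom_eq_0: "n < i \<Longrightarrow> qbinom q n i = 0"
  by (induction q n i rule: qbinom.induct) auto

text \<open>The quotient formula with denominators cleared. The Pascal step rests on (1 - q^(d+1)) +
  q^(d+1) (1 - q^(i+1)) = 1 - q^(n+1) for n = i + d + 1.\<close>

lemma qbinom_qpoch: "i \<le> n \<Longrightarrow> qbinom q n i * (qpoch q i * qpoch q (n - i)) = qpoch q n"
proof (induction q n i rule: qbinom.induct)
  case (3 q n i)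
  show ?case
  proof (cases "i = n")
    case True
    have "qbinom q n n * qpoch q n = qpoch q n"
      using "3.IH"(2) True by (simp add: qpoch_def)
    then have "qbinom q n n * qpoch q n * (1 - q ^ Suc n) = qpoch q n * (1 - q ^ Suc n)"
      by simp
    then show ?thesis using True by (simp add: qbinom_eq_0 qpoch_def) blast
  next
    case False
    with 3 have i: "i < n" by simp
    then obtain d where d: "n = Suc (i + d)" by (metis add_Suc_right less_imp_Suc_add)
    have "qbinom q n (Suc i) * (qpoch q (Suc i) * qpoch q d) = qpoch q n"
      using "3.IH"(1) i by (simp add: d)
    moreover have "qbinom q n i * (qpoch q i * qpoch q (Suc d)) = qpoch q n"
      using "3.IH"(2) i by (simp add: d)
    moreover have "qpoch q (Suc i) = qpoch q i * (1 - q ^ Suc i)" "qpoch q (Suc d) = qpoch q d * (1 - q ^ Suc d)"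
      "qpoch q (Suc n) = qpoch q n * (1 - q ^ Suc n)"
      by (simp_all add: qpoch_def)
    moreover have "(qbinom q n (Suc i) + q ^ Suc d * qbinom q n i) * ((qpoch q i * (1 - q ^ Suc i)) * (qpoch q d * (1 - q ^ Suc d)))
      = (qbinom q n (Suc i) * ((qpoch q i * (1 - q ^ Suc i)) * qpoch q d)) * (1 - q ^ Suc d)
        + (qbinom q n i * (qpoch q i * (qpoch q d * (1 - q ^ Suc d)))) * (q ^ Suc d * (1 - q ^ Suc i))"
      by algebra
    moreover have "qpoch q n * (1 - q ^ Suc d) + qpoch q n * (q ^ Suc d * (1 - q ^ Suc i)) = qpoch q n * (1 - q ^ Suc n)"
      by (simp add: d power_add algebra_simps)
    ultimately show ?thesis
      using d by (simp add: Suc_diff_le)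
  qed
qed (auto simp: qpoch_def)

lemma q_binomial_theorem:
  fixes q t :: "'a::field"
  shows "(\<Prod>k<n. 1 + t * q ^ (2 * k)) = (\<Sum>i\<le>n. qbinom (q\<^sup>2) n i * q ^ (i * (i - 1)) * t ^ i)"
proof (induction n)
  case (Suc n)
  let ?g = "\<lambda>n i. qbinom (q\<^sup>2) n i * q ^ (i * (i - 1)) * t ^ i"
  have e: "q ^ (Suc i * (Suc i - 1)) = q ^ (i * (i - 1)) * q ^ (2 * i)" for i
    unfolding power_add[symmetric] by (rule arg_cong[where f = "(^) q"], cases i) (auto simp: algebra_simps)
  have "(\<Sum>i\<le>Suc n. ?g (Suc n) i) = 1 + (\<Sum>i\<le>n. ?g (Suc n) (Suc i))"
    by (subst sum.atMost_Suc_shift) (simp only: qbinom.simps mult_zero_left power_0 mult_1)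
  also have "(\<Sum>i\<le>n. ?g (Suc n) (Suc i)) = (\<Sum>i\<le>n. ?g n (Suc i) + t * q ^ (2 * n) * ?g n i)"
  proof (rule sum.cong[OF refl])
    fix i assume "i \<in> {..n}"
    then obtain d where d: "n = i + d" by (auto simp: le_iff_add)
    have "(q\<^sup>2) ^ (n - i) * q ^ (2 * i) = q ^ (2 * n)"
      by (simp add: d power_mult[symmetric] power_add[symmetric] algebra_simps)
    note * = this[symmetric]
    show "?g (Suc n) (Suc i) = ?g n (Suc i) + t * q ^ (2 * n) * ?g n i"
      unfolding e qbinom.simps(3) power_Suc * by (simp only: distrib_right distrib_left mult_ac)
  qed
  also have "1 + \<dots> = (\<Sum>i\<le>Suc n. ?g n i) + t * q ^ (2 * n) * (\<Sum>i\<le>n. ?g n i)"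
  proof -
    have "(\<Sum>i\<le>Suc n. ?g n i) = ?g n 0 + (\<Sum>i\<le>n. ?g n (Suc i))" by (rule sum.atMost_Suc_shift)
    then show ?thesis
      by (simp only: qbinom.simps mult_zero_left power_0 mult_1 sum.distrib sum_distrib_left add.assoc)
  qed
  also have "(\<Sum>i\<le>Suc n. ?g n i) = (\<Sum>i\<le>n. ?g n i)"
    by (simp add: qbinom_eq_0)
  also have "\<dots> + t * q ^ (2 * n) * (\<Sum>i\<le>n. ?g n i) = (\<Prod>k<Suc n. 1 + t * q ^ (2 * k))"
    unfolding Suc.IH[symmetric] by (simp add: distrib_left)
  finally show ?case ..
qed simp

section \<open>The finite triple product\<close>

lemma prod_lessThan_add:
  fixes g :: "nat \<Rightarrow> 'a::comm_monoid_mult"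
  shows "(\<Prod>k<m + n. g k) = (\<Prod>k<m. g k) * (\<Prod>k<n. g (m + k))"
  by (induction n) (simp_all add: mult.assoc)

lemma prod_odd_powers: "(\<Prod>k<n. q ^ (2 * k + 1)) = (q :: 'a::comm_monoid_mult) ^ (n * n)"
proof (induction n)
  case (Suc n)
  have "Suc n * Suc n = n * n + (2 * n + 1)" by simp
  then show ?case by (simp only: prod.lessThan_Suc Suc.IH power_add[of q "n * n"])
qed simp

lemma sum_fold_centre:
  fixes f :: "nat \<Rightarrow> 'a::comm_monoid_add"
  shows "(\<Sum>i\<le>2*n. f i) = (\<Sum>j\<le>n. if j = 0 then f n else f (n + j) + f (n - j))"
proof (induction n arbitrary: f)
  case (Suc n)
  have "(\<Sum>i\<le>2 * Suc n. f i) = f 0 + (\<Sum>i\<le>2 * n. f (Suc i)) + f (2 * n + 2)"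
  proof -
    have "(\<Sum>i\<le>2 * Suc n. f i) = (\<Sum>i\<le>Suc (2 * n). f i) + f (2 * n + 2)" by simp
    then show ?thesis by (simp only: sum.atMost_Suc_shift)
  qed
  also have "(\<Sum>i\<le>2 * n. f (Suc i)) = (\<Sum>j\<le>n. if j = 0 then f (Suc n) else f (Suc n + j) + f (Suc n - j))"
    unfolding Suc.IH by (intro sum.cong) (auto simp: Suc_diff_le)
  finally show ?case by (simp add: add_ac mult_2)
qed simp

text \<open>The terms of index j and -j of the two-sided series of q^(j^2) x^j, taken together, so
  that limits only concern series over the naturals.\<close>

definition theta_term :: "complex \<Rightarrow> complex \<Rightarrow> nat \<Rightarrow> complex" where
  "theta_term q x j = (if j = 0 then 1 else q ^ (j * j) * (x ^ j + inverse x ^ j))"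

lemma finite_triple_product:
  fixes q x :: complex
  assumes q: "q \<noteq> 0" and x: "x \<noteq> 0"
  shows "(\<Prod>k<n. (1 + x * q ^ (2 * k + 1)) * (1 + q ^ (2 * k + 1) / x))
    = (\<Sum>j\<le>n. if j = 0 then qbinom (q\<^sup>2) (2 * n) n
         else q ^ (j * j) * (qbinom (q\<^sup>2) (2 * n) (n + j) * x ^ j + qbinom (q\<^sup>2) (2 * n) (n - j) * inverse x ^ j))"
proof -
  \<comment> \<open>With this t, that is x q^(1 - 2n), the last n of the 2n factors of the
    q-binomial product are 1 + x q^(2k+1). The first n, in reverse order, are x q^(-(2k+1)) (1 +
    q^(2k+1) / x), and their extracted monomials multiply to the constant \<open>c\<close>
    below.\<close>
  define t where "t = x * q * inverse q ^ (2 * n)"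
  have "(\<Prod>k<2*n. 1 + t * q ^ (2 * k)) = (\<Prod>k<n. 1 + t * q ^ (2 * k)) * (\<Prod>k<n. 1 + t * q ^ (2 * (n + k)))"
    unfolding mult_2[of n] by (rule prod_lessThan_add)
  also have "(\<Prod>k<n. 1 + t * q ^ (2 * (n + k))) = (\<Prod>k<n. 1 + x * q ^ (2 * k + 1))"
    using q by (intro prod.cong) (auto simp: t_def power_add power_inverse field_simps)
  also have "(\<Prod>k<n. 1 + t * q ^ (2 * k)) = (\<Prod>k<n. 1 + t * q ^ (2 * (n - Suc k)))"
    by (rule prod.nat_diff_reindex[symmetric])
  also have "\<dots> = (\<Prod>k<n. x * inverse q ^ (2 * k + 1) * (1 + q ^ (2 * k + 1) / x))"
  proof (rule prod.cong[OF refl])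
    fix k assume "k \<in> {..<n}"
    then obtain d where d: "n = Suc (k + d)" by (auto dest: less_imp_Suc_add)
    have "t * q ^ (2 * (n - Suc k)) = x * inverse q ^ (2 * k + 1)"
      using q by (simp add: t_def d power_add power_mult power_inverse power2_eq_square power_mult_distrib field_simps)
    then show "1 + t * q ^ (2 * (n - Suc k)) = x * inverse q ^ (2 * k + 1) * (1 + q ^ (2 * k + 1) / x)"
      using q x by (simp add: field_simps power_inverse)
  qed
  also have "\<dots> = x ^ n * inverse q ^ (n * n) * (\<Prod>k<n. 1 + q ^ (2 * k + 1) / x)"
    by (simp only: prod.distrib prod_odd_powers prod_constant card_lessThan)
  finally have prod: "(\<Prod>k<2*n. 1 + t * q ^ (2 * k)) =
     x ^ n * inverse q ^ (n * n) * (\<Prod>k<n. (1 + x * q ^ (2 * k + 1)) * (1 + q ^ (2 * k + 1) / x))"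
    by (simp add: prod.distrib mult_ac)
  define f where "f = (\<lambda>i. qbinom (q\<^sup>2) (2 * n) i * q ^ (i * (i - 1)) * t ^ i)"
  define c where "c = x ^ n * inverse q ^ (n * n)"
  have c0: "c \<noteq> 0" using q x by (simp add: c_def)
  \<comment> \<open>Multiplying by q^(2 n i) turns the negative exponent i^2 - 2 n i into a natural
    one; the factor is cancelled again in \<open>fn\<close>, \<open>fp\<close> and
    \<open>fm\<close>.\<close>
  have ff: "q ^ (i * (i - 1)) * t ^ i * (q ^ (2 * n * i)) = x ^ i * q ^ (i * i)" for i
    using q by (cases i) (simp_all add: t_def power_mult_distrib power_mult[symmetric] power_inverse field_simps power_add[symmetric])
  have fn: "f n = c * qbinom (q\<^sup>2) (2 * n) n"
  proof -
    have "q ^ (n * (n - 1)) * t ^ n = c"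
    proof -
      have "q ^ (n * (n - 1)) * t ^ n * q ^ (2 * n * n) = c * q ^ (2 * n * n)"
        unfolding ff c_def using q by (simp add: power_inverse power_add power_mult field_simps power2_eq_square power_mult_distrib)
      then show ?thesis using q by simp
    qed
    then show ?thesis by (simp add: f_def mult_ac)
  qed
  have fp: "f (n + j) = c * (q ^ (j * j) * (qbinom (q\<^sup>2) (2 * n) (n + j) * x ^ j))" for j
  proof -
    have "q ^ ((n + j) * ((n + j) - 1)) * t ^ (n + j) * q ^ (2 * n * (n + j)) = c * q ^ (j * j) * x ^ j * q ^ (2 * n * (n + j))"
    proof -
      have "q ^ (n * n) * q ^ ((n + j) * (n + j)) = q ^ (j * j) * q ^ (2 * n * (n + j))"
        unfolding power_add[symmetric] by (rule arg_cong[where f = "(^) q"]) (simp add: algebra_simps)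
      then have "q ^ ((n + j) * (n + j)) = inverse q ^ (n * n) * (q ^ (j * j) * q ^ (2 * n * (n + j)))"
        using q by (simp add: power_inverse field_simps)
      then show ?thesis unfolding ff c_def power_add[of x] by (simp only: mult_ac)
    qed
    then have "q ^ ((n + j) * ((n + j) - 1)) * t ^ (n + j) = c * q ^ (j * j) * x ^ j"
      using q by simp
    then show ?thesis by (simp add: f_def mult_ac)
  qed
  have fm: "f (n - j) = c * (q ^ (j * j) * (qbinom (q\<^sup>2) (2 * n) (n - j) * inverse x ^ j))" if jn: "j \<le> n" for j
  proof -
    obtain d where d: "n = j + d" using jn by (auto simp: le_iff_add)
    have "q ^ (d * (d - 1)) * t ^ d * q ^ (2 * n * d) = c * q ^ (j * j) * inverse x ^ j * q ^ (2 * n * d)"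
    proof -
      have "q ^ (n * n) * q ^ (d * d) = q ^ (j * j) * q ^ (2 * n * d)"
        unfolding power_add[symmetric] by (rule arg_cong[where f = "(^) q"]) (simp add: d algebra_simps)
      then have "q ^ (d * d) = inverse q ^ (n * n) * (q ^ (j * j) * q ^ (2 * n * d))"
        using q by (simp add: power_inverse field_simps)
      moreover have "x ^ d = x ^ n * inverse x ^ j"
        using x by (simp add: d power_add power_inverse)
      ultimately show ?thesis unfolding ff c_def by (simp only: mult_ac)
    qed
    then have "q ^ (d * (d - 1)) * t ^ d = c * q ^ (j * j) * inverse x ^ j"
      using q by simp
    then show ?thesis by (simp add: f_def d mult_ac)
  qed
  have "c * (\<Prod>k<n. (1 + x * q ^ (2 * k + 1)) * (1 + q ^ (2 * k + 1) / x)) = (\<Sum>i\<le>2*n. f i)"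
    unfolding f_def c_def prod[symmetric] by (rule q_binomial_theorem)
  also have "\<dots> = (\<Sum>j\<le>n. if j = 0 then f n else f (n + j) + f (n - j))"
    by (rule sum_fold_centre)
  also have "\<dots> = (\<Sum>j\<le>n. c * (if j = 0 then qbinom (q\<^sup>2) (2 * n) n
         else q ^ (j * j) * (qbinom (q\<^sup>2) (2 * n) (n + j) * x ^ j + qbinom (q\<^sup>2) (2 * n) (n - j) * inverse x ^ j)))"
  proof (rule sum.cong[OF refl])
    fix j assume "j \<in> {..n}"
    then have "j \<le> n" by simp
    then show "(if j = 0 then f n else f (n + j) + f (n - j)) = c * (if j = 0 then qbinom (q\<^sup>2) (2 * n) n
         else q ^ (j * j) * (qbinom (q\<^sup>2) (2 * n) (n + j) * x ^ j + qbinom (q\<^sup>2) (2 * n) (n - j) * inverse x ^ j))"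
      by (simp only: fn fp fm distrib_left if_distrib[of "\<lambda>z. c * z"])
  qed
  finally show ?thesis
    using c0 by (simp only: sum_distrib_left[symmetric] mult_cancel_left) simp
qed

text \<open>From 1 / (1 - a) = 1 + a / (1 - a) \<le> exp (a / (1 - a)), with the exponents summed by
  a geometric series. The bound does not depend on n, so limits of such products stay strictly
  positive.\<close>

lemma prod_one_minus_lower_bound:
  fixes r :: real
  assumes r: "0 < r" "r < 1" and a: "\<And>m. 0 \<le> a m" "\<And>m. a m \<le> r ^ Suc m"
  shows "exp (- (1 / (1 - r)\<^sup>2)) \<le> (\<Prod>m<n. 1 - a m)"
proof -
  have "exp (- (1 / (1 - r)\<^sup>2)) \<le> exp (- (\<Sum>m<n. r ^ m / (1 - r)))"
  proof -
    have "(\<Sum>m<n. r ^ m) \<le> (\<Sum>m. r ^ m)"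
      using r by (intro sum_le_suminf) auto
    also have "\<dots> = 1 / (1 - r)" using r by (simp add: suminf_geometric)
    finally have "(\<Sum>m<n. r ^ m) / (1 - r) \<le> 1 / (1 - r) / (1 - r)"
      using r by (intro divide_right_mono) auto
    then show ?thesis by (simp add: sum_divide_distrib power2_eq_square)
  qed
  also have "\<dots> = (\<Prod>m<n. exp (- (r ^ m / (1 - r))))"
    by (simp add: exp_sum sum_negf[symmetric])
  also have "\<dots> \<le> (\<Prod>m<n. 1 - a m)"
  proof (rule prod_mono, intro conjI)
    fix m
    have am: "a m \<le> r" using a(2)[of m] power_decreasing[of 1 "Suc m" r] r by (simp del: power_Suc)
    have "r ^ Suc m \<le> r ^ m" using r by (intro power_decreasing) auto
    then have "a m \<le> r ^ m" by (rule order_trans[OF a(2)])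
    then have "a m / (1 - a m) \<le> r ^ m / (1 - r)"
      using am r a(1)[of m] by (intro frac_le) auto
    then have "1 / (1 - a m) \<le> 1 + r ^ m / (1 - r)"
      using am r by (simp add: field_simps)
    also have "\<dots> \<le> exp (r ^ m / (1 - r))" by (rule exp_ge_add_one_self)
    finally show "exp (- (r ^ m / (1 - r))) \<le> 1 - a m"
      using am r by (simp add: exp_minus field_simps)
  qed simp
  finally show ?thesis .
qed

section \<open>Passage to the infinite triple product\<close>

definition qlim :: "real \<Rightarrow> real" where
  "qlim Q = lim (qpoch Q)"

context
  fixes Q :: real
  assumes Q: "0 < Q" "Q < 1"
begin

lemma qpoch_le_1: "0 < qpoch Q n" "qpoch Q n \<le> 1"
  unfolding qpoch_def using Q power_Suc_less_one[of Q]
  by (auto intro!: prod_pos prod_le_1 simp: less_imp_le power_Suc[symmetric] simp del: power_Suc)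

lemma qpoch_decseq: "decseq (qpoch Q)"
  unfolding decseq_Suc_iff
proof
  fix n
  have "qpoch Q (Suc n) = qpoch Q n * (1 - Q ^ Suc n)" by (simp add: qpoch_def)
  also have "\<dots> \<le> qpoch Q n * 1"
    using Q qpoch_le_1(1)[of n] by (intro mult_left_mono) auto
  finally show "qpoch Q (Suc n) \<le> qpoch Q n" by simp
qed

lemma qpoch_tendsto: "qpoch Q \<longlonglongrightarrow> qlim Q"
  using decseq_bounded[OF qpoch_decseq, of 0] decseq_convergent[OF qpoch_decseq, of 0] qpoch_le_1(1)
  unfolding qlim_def by (metis less_imp_le limI)

lemma qlim_pos: "0 < qlim Q"
proof -
  have "exp (- (1 / (1 - Q)\<^sup>2)) \<le> qlim Q"
    using Q by (intro LIMSEQ_le_const[OF qpoch_tendsto] exI[of _ 0] allI impI)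
      (unfold qpoch_def, rule prod_one_minus_lower_bound, auto)
  then show ?thesis by (meson exp_gt_zero less_le_trans)
qed

lemma qlim_le_qpoch: "qlim Q \<le> qpoch Q n"
  using decseq_ge[OF qpoch_decseq qpoch_tendsto] .

end

text \<open>Jacobi's theta_3 of nome q in the variable x = exp(2 i z). At -x it is theta_4, and at -
  q x it is theta_1 up to the factor - i q^(1/4) x^(1/2).\<close>

definition theta :: "real \<Rightarrow> complex \<Rightarrow> complex" where
  "theta q x = (\<Sum>n. theta_term (of_real q) x n)"

lemma summable_gaussian_power:
  fixes q r :: real
  assumes "0 < q" "q < 1" "0 \<le> r"
  shows "summable (\<lambda>j. q ^ (j * j) * r ^ j)"
proof (rule summable_comparison_test_ev)
  have "(\<lambda>j. q ^ j * r) \<longlonglongrightarrow> 0 * r"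
    using assms by (intro tendsto_mult LIMSEQ_power_zero) auto
  then have "eventually (\<lambda>j. q ^ j * r < 1 / 2) sequentially"
    by (intro order_tendstoD) auto
  then show "eventually (\<lambda>j. norm (q ^ (j * j) * r ^ j) \<le> (1 / 2) ^ j) sequentially"
  proof eventually_elim
    case (elim j)
    have "(q ^ j * r) ^ j \<le> (1 / 2) ^ j"
      using elim assms by (intro power_mono) auto
    then show ?case
      using assms by (simp add: power_mult_distrib power_mult)
  qed
  show "summable (\<lambda>j. (1 / 2 :: real) ^ j)" by (simp add: summable_geometric)
qed

lemma summable_norm_theta_term:
  assumes "0 < q" "q < 1"
  shows "summable (\<lambda>j. norm (theta_term (of_real q) x j))"
proof (rule summable_comparison_test_ev)
  let ?M = "\<lambda>j. q ^ (j * j) * norm x ^ j + q ^ (j * j) * norm (inverse x) ^ j"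
  show "summable ?M"
    using assms by (intro summable_add summable_gaussian_power) auto
  have "norm (norm (theta_term (of_real q) x j)) \<le> ?M j" if "j > 0" for j
  proof -
    have "norm (theta_term (of_real q) x j) = q ^ (j * j) * norm (x ^ j + inverse x ^ j)"
      using that assms by (simp add: theta_term_def norm_mult norm_power)
    also have "\<dots> \<le> q ^ (j * j) * (norm (x ^ j) + norm (inverse x ^ j))"
      using assms by (intro mult_left_mono norm_triangle_ineq) auto
    finally show ?thesis by (simp add: norm_power distrib_left)
  qed
  then show "eventually (\<lambda>j. norm (norm (theta_term (of_real q) x j)) \<le> ?M j) sequentially"
    by (intro eventually_sequentiallyI[of 1]) auto
qed

lemma qpoch_of_real: "qpoch (of_real Q) n = (of_real (qpoch Q n) :: complex)"
  by (simp add: qpoch_def)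

lemma qbinom_of_real:
  assumes "0 < Q" "Q < 1" "i \<le> n"
  shows "qbinom (of_real Q :: complex) n i = of_real (qpoch Q n / (qpoch Q i * qpoch Q (n - i)))"
proof -
  have nz: "qpoch Q i * qpoch Q (n - i) \<noteq> 0"
    using qpoch_le_1(1)[OF assms(1,2)] by (metis less_irrefl mult_pos_pos)
  have "qbinom (of_real Q :: complex) n i * of_real (qpoch Q i * qpoch Q (n - i)) = of_real (qpoch Q n)"
    using qbinom_qpoch[OF assms(3), of "of_real Q :: complex"] by (simp add: qpoch_of_real)
  then show ?thesis using nz by (simp add: nonzero_eq_divide_eq del: of_real_mult)
qed

text \<open>Dominated convergence for series applied to the finite identity. With L = (q^2;
  q^2)_infinity, each coefficient \<open>c n j\<close> tends to L / (L L) and is at most 1 / (L L),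
  since the finite products lie between L and 1.\<close>

theorem jacobi_triple_product:
  assumes q: "0 < q" "q < 1" and x: "x \<noteq> 0"
  shows "(\<lambda>n. \<Prod>k<n. (1 + x * of_real (q ^ (2 * k + 1))) * (1 + of_real (q ^ (2 * k + 1)) / x))
           \<longlonglongrightarrow> theta q x / of_real (qlim (q\<^sup>2))"
proof -
  have Q: "0 < q\<^sup>2" "q\<^sup>2 < 1" using q by (auto simp: power_less_one_iff)
  define c where "c = (\<lambda>n j. qpoch (q\<^sup>2) (2 * n) / (qpoch (q\<^sup>2) (n + j) * qpoch (q\<^sup>2) (n - j)))"
  define a where "a = (\<lambda>j n. if j \<le> n then of_real (c n j) * theta_term (of_real q) x j else 0)"
  let ?L = "qlim (q\<^sup>2)"
  note L = qlim_pos[OF Q]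
  have fin: "(\<Prod>k<n. (1 + x * of_real (q ^ (2 * k + 1))) * (1 + of_real (q ^ (2 * k + 1)) / x)) = (\<Sum>j. a j n)" for n
  proof -
    have "(\<Prod>k<n. (1 + x * of_real (q ^ (2 * k + 1))) * (1 + of_real (q ^ (2 * k + 1)) / x)) = (\<Sum>j\<le>n. a j n)"
      unfolding of_real_power
    proof (subst finite_triple_product[OF _ x], goal_cases)
      case 1 then show ?case using q by simp
    next
      case 2
      show ?case
      proof (rule sum.cong[OF refl])
        fix j assume "j \<in> {..n}"
        then have j: "j \<le> n" by simp
        have 1: "qbinom ((complex_of_real q)\<^sup>2) (2 * n) (n + j) = of_real (c n j)"
          using qbinom_of_real[OF Q, of "n + j" "2 * n"] j by (simp add: c_def mult_2)
        have 0: "qbinom ((complex_of_real q)\<^sup>2) (2 * n) n = of_real (c n 0)"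
          using qbinom_of_real[OF Q, of n "2 * n"] by (simp add: c_def mult_2)
        have "2 * n - (n - j) = n + j" using j by simp
        then have 2: "qbinom ((complex_of_real q)\<^sup>2) (2 * n) (n - j) = of_real (c n j)"
          using qbinom_of_real[OF Q, of "n - j" "2 * n"] j by (simp add: c_def mult.commute)
        show "(if j = 0 then qbinom ((complex_of_real q)\<^sup>2) (2 * n) n
         else complex_of_real q ^ (j * j) * (qbinom ((complex_of_real q)\<^sup>2) (2 * n) (n + j) * x ^ j
               + qbinom ((complex_of_real q)\<^sup>2) (2 * n) (n - j) * inverse x ^ j)) = a j n"
          using j unfolding 0 1 2 by (auto simp: a_def theta_term_def distrib_left mult_ac)
      qed
    qed
    also have "\<dots> = (\<Sum>j. a j n)"
      by (intro suminf_finite[symmetric]) (auto simp: a_def)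
    finally show ?thesis .
  qed
  have lim: "(\<lambda>n. a j n) \<longlonglongrightarrow> theta_term (of_real q) x j / of_real ?L" for j
  proof -
    have t1: "(\<lambda>n. qpoch (q\<^sup>2) (2 * n)) \<longlonglongrightarrow> ?L"
      by (intro filterlim_compose[OF qpoch_tendsto[OF Q]] mult_nat_left_at_top) auto
    have t2: "(\<lambda>n. qpoch (q\<^sup>2) (n + j)) \<longlonglongrightarrow> ?L"
      by (rule LIMSEQ_ignore_initial_segment[OF qpoch_tendsto[OF Q]])
    have t3: "(\<lambda>n. qpoch (q\<^sup>2) (n - j)) \<longlonglongrightarrow> ?L"
      by (intro filterlim_compose[OF qpoch_tendsto[OF Q]] filterlim_minus_const_nat_at_top)
    have "(\<lambda>n. c n j) \<longlonglongrightarrow> ?L / (?L * ?L)"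
      unfolding c_def using L by (intro tendsto_intros t1 t2 t3) auto
    then have "(\<lambda>n. of_real (c n j) * theta_term (of_real q) x j) \<longlonglongrightarrow> of_real (1 / ?L) * theta_term (of_real q) x j"
      using L by (intro tendsto_intros) auto
    then show ?thesis
      by (rule Lim_transform_eventually[THEN tendsto_eq_rhs])
        (auto simp: a_def intro!: eventually_sequentiallyI[of j])
  qed
  have bound: "norm (a j n) \<le> 1 / (?L * ?L) * norm (theta_term (of_real q) x j)" for j n
  proof -
    have "c n j \<le> 1 / (?L * ?L)"
      unfolding c_def using qpoch_le_1[OF Q] qlim_le_qpoch[OF Q] L
      by (intro frac_le mult_mono) (auto intro: less_imp_le)
    moreover have "c n j \<ge> 0"
      unfolding c_def using qpoch_le_1(1)[OF Q] by (intro divide_nonneg_pos) (auto intro: less_imp_le)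
    ultimately have "\<bar>c n j\<bar> * norm (theta_term (of_real q) x j) \<le> 1 / (?L * ?L) * norm (theta_term (of_real q) x j)"
      by (intro mult_right_mono) auto
    then show ?thesis using L by (simp add: a_def norm_mult)
  qed
  have "(\<lambda>n. \<Sum>j. a j n) \<longlonglongrightarrow> (\<Sum>j. theta_term (of_real q) x j / of_real ?L)"
    using tannerys_theorem[of a "\<lambda>j. theta_term (of_real q) x j / of_real ?L" sequentially
        "\<lambda>j. 1 / (?L * ?L) * norm (theta_term (of_real q) x j)"]
      lim bound summable_mult[OF summable_norm_theta_term[OF q], of "1 / (?L * ?L)" x]
    by (auto simp: case_prod_unfold)
  also have "(\<Sum>j. theta_term (of_real q) x j / of_real ?L) = theta q x / of_real ?L"
    unfolding theta_def
    by (rule suminf_divide) (rule summable_norm_cancel[OF summable_norm_theta_term[OF q]])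
  finally show ?thesis unfolding fin .
qed

section \<open>Two-sided series and quadratic theta relations\<close>

lemma has_sum_int:
  fixes f :: "int \<Rightarrow> complex"
  assumes pos: "summable (\<lambda>n. norm (f (int n)))" and neg: "summable (\<lambda>n. norm (f (- int n)))"
  shows "(\<lambda>j. norm (f j)) summable_on UNIV"
    and "(f has_sum (\<Sum>n. if n = 0 then f 0 else f (int n) + f (- int n))) UNIV"
proof -
  let ?g = "\<lambda>n. f (- int (Suc n))"
  have neg': "summable (\<lambda>n. norm (?g n))" using neg by (subst summable_Suc_iff)
  have split: "(UNIV :: int set) = range int \<union> range (\<lambda>n. - int (Suc n))"
  proof (rule UNIV_eq_I)
    fix j :: int
    show "j \<in> range int \<union> range (\<lambda>n. - int (Suc n))" by (cases j rule: int_cases) blast+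
  qed
  have disj: "range int \<inter> range (\<lambda>n. - int (Suc n)) = {}" by auto
  have inj: "inj int" "inj (\<lambda>n. - int (Suc n))" by (auto simp: inj_def)
  have union: "(F has_sum a + b) UNIV"
    if "((\<lambda>n. F (int n)) has_sum a) UNIV" "((\<lambda>n. F (- int (Suc n))) has_sum b) UNIV"
    for F :: "int \<Rightarrow> 'b::real_normed_vector" and a b
    unfolding split
    by (rule has_sum_Un_disjoint[OF has_sum_reindex[OF inj(1), THEN iffD2, unfolded o_def]
            has_sum_reindex[OF inj(2), THEN iffD2, unfolded o_def] disj, OF that])
  have "(\<lambda>n. norm (f (int n))) summable_on UNIV" "(\<lambda>n. norm (?g n)) summable_on UNIV"
    using norm_summable_imp_summable_on[of "\<lambda>n. norm (f (int n))"] norm_summable_imp_summable_on[of "\<lambda>n. norm (?g n)"]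
      pos neg' by simp_all
  then show "(\<lambda>j. norm (f j)) summable_on UNIV"
    unfolding summable_on_def using union[of "\<lambda>j. norm (f j)"] by (elim exE) (rule exI)
  have h: "(f has_sum ((\<Sum>n. f (int n)) + (\<Sum>n. ?g n))) UNIV"
    by (rule union[OF norm_summable_imp_has_sum[OF pos summable_sums[OF summable_norm_cancel[OF pos]]]
          norm_summable_imp_has_sum[OF neg' summable_sums[OF summable_norm_cancel[OF neg']]]])
  have "(\<lambda>n. f (- int (Suc n))) sums (\<Sum>n. ?g n)"
    by (rule summable_sums[OF summable_norm_cancel[OF neg']])
  then have "(\<lambda>n. if n = 0 then 0 else f (- int n)) sums (\<Sum>n. ?g n)"
    by (subst sums_Suc_iff[of "\<lambda>n. if n = 0 then 0 else f (- int n)", simplified, symmetric]) simp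
  moreover have "(\<lambda>n. f (int n)) sums (\<Sum>n. f (int n))"
    by (rule summable_sums[OF summable_norm_cancel[OF pos]])
  ultimately have "(\<lambda>n. f (int n) + (if n = 0 then 0 else f (- int n))) sums ((\<Sum>n. f (int n)) + (\<Sum>n. ?g n))"
    by (intro sums_add)
  also have "(\<lambda>n. f (int n) + (if n = 0 then 0 else f (- int n))) = (\<lambda>n. if n = 0 then f 0 else f (int n) + f (- int n))"
    by auto
  finally show "(f has_sum (\<Sum>n. if n = 0 then f 0 else f (int n) + f (- int n))) UNIV"
    using h by (simp add: sums_iff)
qed

text \<open>The same series with integer index. As an absolutely convergent unordered sum, a product
  of two of them can be regrouped freely by substitutions on pairs of indices.\<close>

definition theta_int :: "real \<Rightarrow> complex \<Rightarrow> int \<Rightarrow> complex" where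
  "theta_int q x j = of_real q powi (j * j) * x powi j"

lemma theta_has_sum:
  assumes q: "0 < q" "q < 1"
  shows "(\<lambda>j. norm (theta_int q x j)) summable_on UNIV" and "(theta_int q x has_sum theta q x) UNIV"
proof -
  have p: "theta_int q x (int n) = of_real q ^ (n * n) * x ^ n" for n
    unfolding theta_int_def of_nat_mult[symmetric] power_int_of_nat ..
  have m: "theta_int q x (- int n) = of_real q ^ (n * n) * inverse x ^ n" for n
    unfolding theta_int_def minus_mult_minus of_nat_mult[symmetric] power_int_of_nat
    by (simp add: power_int_minus power_inverse)
  have sp: "summable (\<lambda>n. norm (theta_int q x (int n)))"
    unfolding p using summable_gaussian_power[OF q, of "norm x"] q by (simp add: norm_mult norm_power)
  have sm: "summable (\<lambda>n. norm (theta_int q x (- int n)))"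
    unfolding m using summable_gaussian_power[OF q, of "norm (inverse x)"] q by (simp add: norm_mult norm_power norm_inverse)
  note * = has_sum_int[OF sp sm]
  show "(\<lambda>j. norm (theta_int q x j)) summable_on UNIV" by (rule *(1))
  have "(\<Sum>n. if n = 0 then theta_int q x 0 else theta_int q x (int n) + theta_int q x (- int n)) = theta q x"
    unfolding theta_def p m
    by (intro arg_cong[where f = suminf] ext) (simp add: theta_term_def theta_int_def distrib_left)
  with *(2) show "(theta_int q x has_sum theta q x) UNIV" by simp
qed

lemma has_sum_times:
  fixes f :: "'a \<Rightarrow> complex" and g :: "'b \<Rightarrow> complex"
  assumes "(\<lambda>i. norm (f i)) summable_on A" "(\<lambda>j. norm (g j)) summable_on B" "(f has_sum a) A" "(g has_sum b) B"
  shows "((\<lambda>(i, j). f i * g j) has_sum a * b) (A \<times> B)"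
proof (rule has_sum_SigmaI)
  show "((\<lambda>j. case (i, j) of (i, j) \<Rightarrow> f i * g j) has_sum f i * b) B" for i
    using has_sum_cmult_right[OF assms(4), of "f i"] by simp
  show "((\<lambda>i. f i * b) has_sum a * b) A"
    by (rule has_sum_cmult_left[OF assms(3)])
  have "(\<lambda>p. norm (case p of (i, j) \<Rightarrow> f i * g j)) summable_on (A \<times> B)"
    unfolding Infinite_Sum.abs_summable_on_Sigma_iff
  proof (intro conjI ballI)
    show "(\<lambda>j. norm (case (i, j) of (i, j) \<Rightarrow> f i * g j)) summable_on B" for i
      using assms(2) by (simp add: norm_mult summable_on_cmult_right)
    show "(\<lambda>i. norm (\<Sum>\<^sub>\<infinity>j\<in>B. norm (case (i, j) of (i, j) \<Rightarrow> f i * g j))) summable_on A"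
      using assms(1) by (simp add: norm_mult infsum_cmult_right' abs_mult summable_on_cmult_left)
  qed
  then show "(\<lambda>(i, j). f i * g j) summable_on (A \<times> B)"
    by (rule abs_summable_summable)
qed

lemma theta_prod_has_sum:
  assumes "0 < q" "q < 1"
  shows "((\<lambda>(m, n). theta_int q x m * theta_int q y n) has_sum theta q x * theta q y) UNIV"
  using has_sum_times[OF theta_has_sum(1)[OF assms] theta_has_sum(1)[OF assms] theta_has_sum(2)[OF assms] theta_has_sum(2)[OF assms]]
  by simp

lemma theta_int_minus: "theta_int q (- x) j = (- 1) powi j * theta_int q x j"
  using power_int_mult_distrib[of "-1" x j] by (simp add: theta_int_def mult_ac)

lemma minus_one_powi: "(- 1 :: complex) powi k = (if even k then 1 else - 1)"
  by (simp add: power_int_minus_left)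

lemma of_real_square_powi: "of_real (q\<^sup>2) powi k = (of_real q powi (2 * k) :: complex)"
  by (simp add: power_int_mult)

lemma theta_int_shift:
  "theta_int q (- (of_real q * z)) j = (- 1) powi j * (of_real q powi (j * j) * of_real q powi j) * z powi j"
  unfolding theta_int_minus by (simp add: theta_int_def power_int_mult_distrib mult_ac)

text \<open>The two quadratic theta relations: substitute \<open>(m, n) = (a + b + 1, a - b)\<close> on pairs of different
  parity and \<open>(m, n) = (a + b, a - b)\<close> on pairs of equal parity.\<close>

lemma theta_diff:
  assumes q: "0 < q" "q < 1" and x: "x \<noteq> 0" and y: "y \<noteq> 0"
  shows "theta q x * theta q (- y) - theta q (- x) * theta q y
    = 2 * of_real q * x * (theta (q\<^sup>2) (- (of_real (q\<^sup>2) * (x * y))) * theta (q\<^sup>2) (- (of_real (q\<^sup>2) * (x / y))))"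
proof -
  have q2: "0 < q\<^sup>2" "q\<^sup>2 < 1" using q by (auto simp: power_less_one_iff)
  define T where "T = theta q x * theta q (- y) - theta q (- x) * theta q y"
  let ?f = "\<lambda>(m, n). theta_int q x m * theta_int q (- y) n - theta_int q (- x) m * theta_int q y n"
  let ?S = "{(m, n). odd (m + n)} :: (int \<times> int) set"
  let ?u = "(- (of_real (q\<^sup>2) * (x * y)))" and ?v = "(- (of_real (q\<^sup>2) * (x / y)))"
  let ?g = "\<lambda>(a, b). 2 * of_real q * x * (theta_int (q\<^sup>2) ?u a * theta_int (q\<^sup>2) ?v b)"
  have "(?f has_sum T) UNIV"
    using has_sum_add[OF theta_prod_has_sum[OF q, of x "- y"] has_sum_uminusI[OF theta_prod_has_sum[OF q, of "- x" y]]]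
    by (simp add: case_prod_unfold T_def)
  \<comment> \<open>The term at (m, n) carries the sign difference (-1)^n - (-1)^m, which vanishes
    for equal parity.\<close>
  moreover have "(?f has_sum T) UNIV \<longleftrightarrow> (?f has_sum T) ?S"
  proof (rule has_sum_cong_neutral)
    show "?f p = 0" if "p \<in> UNIV - ?S" for p
      using that by (cases p) (auto simp: theta_int_minus minus_one_powi)
  qed auto
  moreover have "(?g has_sum T) UNIV \<longleftrightarrow> (?f has_sum T) ?S"
  proof (rule has_sum_reindex_bij_witness[where j = "\<lambda>(a, b). (a + b + 1, a - b)"
        and i = "\<lambda>(m, n). ((m + n - 1) div 2, (m - n - 1) div 2)"])
    show "(case (case p of (a, b) \<Rightarrow> (a + b + 1, a - b)) of (m, n) \<Rightarrow> ((m + n - 1) div 2, (m - n - 1) div 2)) = p" for p :: "int \<times> int"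
      by (cases p) simp
    show "(case p of (a, b) \<Rightarrow> (a + b + 1, a - b)) \<in> ?S" for p :: "int \<times> int"
      by (cases p) (simp only: prod.case mem_Collect_eq, presburger)
    show "(case (case p of (m, n) \<Rightarrow> ((m + n - 1) div 2, (m - n - 1) div 2)) of (a, b) \<Rightarrow> (a + b + 1, a - b)) = p" if "p \<in> ?S" for p :: "int \<times> int"
    proof (cases p)
      case (Pair m n)
      with that have "odd (m + n)" by simp
      then show ?thesis unfolding Pair prod.case prod.inject by presburger
    qed
  next
    fix p :: "int \<times> int"
    obtain a b where p: "p = (a, b)" by fastforce
    have 1: "(- 1 :: complex) powi (a - b) - (- 1) powi (a + b + 1) = 2 * ((- 1) powi a * (- 1) powi b)"
      by (auto simp: minus_one_powi)
    have 2: "of_real q powi ((a + b + 1) * (a + b + 1)) * of_real q powi ((a - b) * (a - b))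
       = of_real q * (of_real (q\<^sup>2) powi (a * a) * of_real (q\<^sup>2) powi a * (of_real (q\<^sup>2) powi (b * b) * of_real (q\<^sup>2) powi b) :: complex)"
    proof -
      \<comment> \<open>The linear terms 2 a and 2 b become the shift by q^2 in both arguments on
        the right-hand side, the constant 1 becomes its prefactor q.\<close>
      have "(a + b + 1) * (a + b + 1) + (a - b) * (a - b) = 2 * (a * a) + 2 * a + (2 * (b * b) + 2 * b) + 1"
        by (simp add: algebra_simps)
      note * = this
      have nz: "(of_real q :: complex) \<noteq> 0" using q by simp
      show ?thesis
        by (simp only: of_real_square_powi power_int_add[OF disjI1[OF nz], symmetric] *) (rule power_int_add_1'[OF disjI1[OF nz]])
    qed
    have 3: "x powi (a + b + 1) * y powi (a - b) = x * ((x * y) powi a * (x / y) powi b)"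
      using x y by (simp add: power_int_add power_int_diff power_int_mult_distrib power_int_divide_distrib)
    have "?f (a + b + 1, a - b) = ((- 1 :: complex) powi (a - b) - (- 1) powi (a + b + 1))
        * (of_real q powi ((a + b + 1) * (a + b + 1)) * of_real q powi ((a - b) * (a - b))) * (x powi (a + b + 1) * y powi (a - b))"
      by (simp only: prod.case theta_int_minus) (simp only: theta_int_def ring_distribs mult_ac)
    also have "\<dots> = 2 * ((- 1) powi a * (- 1) powi b) * (of_real q * (of_real (q\<^sup>2) powi (a * a) * of_real (q\<^sup>2) powi a * (of_real (q\<^sup>2) powi (b * b) * of_real (q\<^sup>2) powi b))) * (x * ((x * y) powi a * (x / y) powi b))"
      by (simp only: 1 2 3)
    also have "\<dots> = ?g (a, b)"
      by (simp only: prod.case theta_int_shift) (simp only: mult_ac)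
    finally show "?f (case p of (a, b) \<Rightarrow> (a + b + 1, a - b)) = ?g p"
      by (simp only: p prod.case)
  qed auto
  ultimately have "(?g has_sum T) UNIV" by (simp only:)
  moreover have "(?g has_sum 2 * of_real q * x * (theta (q\<^sup>2) ?u * theta (q\<^sup>2) ?v)) UNIV"
    using has_sum_cmult_right[OF theta_prod_has_sum[OF q2, of ?u ?v], of "2 * of_real q * x"]
    by (simp only: case_prod_unfold)
  ultimately show ?thesis unfolding T_def by (rule has_sum_unique)
qed

lemma theta_sum:
  assumes q: "0 < q" "q < 1" and x: "x \<noteq> 0" and y: "y \<noteq> 0"
  shows "theta q x * theta q (- y) + theta q (- x) * theta q y
    = 2 * (theta (q\<^sup>2) (- (x * y)) * theta (q\<^sup>2) (- (x / y)))"
proof -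
  have q2: "0 < q\<^sup>2" "q\<^sup>2 < 1" using q by (auto simp: power_less_one_iff)
  define T where "T = theta q x * theta q (- y) + theta q (- x) * theta q y"
  let ?f = "\<lambda>(m, n). theta_int q x m * theta_int q (- y) n + theta_int q (- x) m * theta_int q y n"
  let ?S = "{(m, n). even (m + n)} :: (int \<times> int) set"
  let ?u = "(- (x * y))" and ?v = "(- (x / y))"
  let ?g = "\<lambda>(a, b). 2 * (theta_int (q\<^sup>2) ?u a * theta_int (q\<^sup>2) ?v b)"
  have "(?f has_sum T) UNIV"
    using has_sum_add[OF theta_prod_has_sum[OF q, of x "- y"] theta_prod_has_sum[OF q, of "- x" y]]
    by (simp add: case_prod_unfold T_def)
  moreover have "(?f has_sum T) UNIV \<longleftrightarrow> (?f has_sum T) ?S"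
  proof (rule has_sum_cong_neutral)
    show "?f p = 0" if "p \<in> UNIV - ?S" for p
      using that by (cases p) (auto simp: theta_int_minus minus_one_powi)
  qed auto
  moreover have "(?g has_sum T) UNIV \<longleftrightarrow> (?f has_sum T) ?S"
  proof (rule has_sum_reindex_bij_witness[where j = "\<lambda>(a, b). (a + b, a - b)"
        and i = "\<lambda>(m, n). ((m + n) div 2, (m - n) div 2)"])
    show "(case (case p of (a, b) \<Rightarrow> (a + b, a - b)) of (m, n) \<Rightarrow> ((m + n) div 2, (m - n) div 2)) = p" for p :: "int \<times> int"
      by (cases p) simp
    show "(case p of (a, b) \<Rightarrow> (a + b, a - b)) \<in> ?S" for p :: "int \<times> int"
      by (cases p) (simp only: prod.case mem_Collect_eq, presburger)
    show "(case (case p of (m, n) \<Rightarrow> ((m + n) div 2, (m - n) div 2)) of (a, b) \<Rightarrow> (a + b, a - b)) = p" if "p \<in> ?S" for p :: "int \<times> int"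
    proof (cases p)
      case (Pair m n)
      with that have "even (m + n)" by simp
      then show ?thesis unfolding Pair prod.case prod.inject by presburger
    qed
  next
    fix p :: "int \<times> int"
    obtain a b where p: "p = (a, b)" by fastforce
    have 1: "(- 1 :: complex) powi (a - b) + (- 1) powi (a + b) = 2 * ((- 1) powi a * (- 1) powi b)"
      by (auto simp: minus_one_powi)
    have 2: "of_real q powi ((a + b) * (a + b)) * of_real q powi ((a - b) * (a - b))
       = (of_real (q\<^sup>2) powi (a * a) * of_real (q\<^sup>2) powi (b * b) :: complex)"
    proof -
      have "(a + b) * (a + b) + (a - b) * (a - b) = 2 * (a * a) + 2 * (b * b)"
        by (simp add: algebra_simps)
      note * = this
      have nz: "(of_real q :: complex) \<noteq> 0" using q by simp
      show ?thesis
        by (simp only: of_real_square_powi power_int_add[OF disjI1[OF nz], symmetric] *)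
    qed
    have 3: "x powi (a + b) * y powi (a - b) = (x * y) powi a * (x / y) powi b"
      using x y by (simp add: power_int_add power_int_diff power_int_mult_distrib power_int_divide_distrib)
    have "?f (a + b, a - b) = ((- 1 :: complex) powi (a - b) + (- 1) powi (a + b))
        * (of_real q powi ((a + b) * (a + b)) * of_real q powi ((a - b) * (a - b))) * (x powi (a + b) * y powi (a - b))"
      by (simp only: prod.case theta_int_minus) (simp only: theta_int_def ring_distribs mult_ac)
    also have "\<dots> = 2 * ((- 1) powi a * (- 1) powi b) * (of_real (q\<^sup>2) powi (a * a) * of_real (q\<^sup>2) powi (b * b)) * ((x * y) powi a * (x / y) powi b)"
      by (simp only: 1 2 3)
    also have "\<dots> = ?g (a, b)"
      by (simp only: prod.case theta_int_minus) (simp only: theta_int_def mult_ac)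
    finally show "?f (case p of (a, b) \<Rightarrow> (a + b, a - b)) = ?g p"
      by (simp only: p prod.case)
  qed auto
  ultimately have "(?g has_sum T) UNIV" by (simp only:)
  moreover have "(?g has_sum 2 * (theta (q\<^sup>2) ?u * theta (q\<^sup>2) ?v)) UNIV"
    using has_sum_cmult_right[OF theta_prod_has_sum[OF q2, of ?u ?v], of "2"]
    by (simp only: case_prod_unfold)
  ultimately show ?thesis unfolding T_def by (rule has_sum_unique)
qed

section \<open>Blaschke products at theta quotients\<close>

lemma square_unit_interval: "0 < q \<Longrightarrow> q < 1 \<Longrightarrow> 0 < q\<^sup>2 \<and> q\<^sup>2 < 1" for q :: real
  by (simp add: power_less_one_iff)

lemma odd_power_less_1:
  fixes q :: real
  assumes "0 < q" "q < 1"
  shows "0 \<le> q ^ (2 * k + 1)" "q ^ (2 * k + 1) < 1"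
proof -
  show "0 \<le> q ^ (2 * k + 1)" using assms by simp
  show "q ^ (2 * k + 1) < 1" using power_Suc_less_one[OF assms, of "2 * k"] by simp
qed

text \<open>On the unit circle the two factors of the triple product are conjugate. Hence theta is
  real and positive there, for both signs of its argument.\<close>

lemma one_plus_mult_cnj:
  fixes x :: complex
  assumes "norm x = 1"
  shows "(1 + x * of_real p) * (1 + of_real p / x) = of_real ((norm (1 + x * of_real p))\<^sup>2)"
proof -
  have "of_real p / x = cnj (x * of_real p)"
    using assms by (simp add: divide_conv_cnj mult.commute)
  then have "1 + of_real p / x = cnj (1 + x * of_real p)" by simp
  then show ?thesis by (simp only: complex_norm_square)
qed

definition theta_re :: "real \<Rightarrow> complex \<Rightarrow> real" where
  "theta_re q x = Re (theta q x)"

lemma norm_one_plus_bounds: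
  fixes x :: complex
  assumes "norm x = 1" "0 \<le> p"
  shows "1 - p \<le> norm (1 + x * of_real p)" "norm (1 + x * of_real p) \<le> 1 + p"
  using norm_triangle_ineq[of 1 "x * of_real p"] norm_triangle_ineq2[of 1 "- (x * of_real p)"] assms
  by (simp_all add: norm_mult)

lemma theta_re_tendsto:
  assumes q: "0 < q" "q < 1" and x: "norm x = 1"
  shows "(\<lambda>n. \<Prod>k<n. (norm (1 + x * of_real (q ^ (2 * k + 1))))\<^sup>2) \<longlonglongrightarrow> theta_re q x / qlim (q\<^sup>2)" (is "?P \<longlonglongrightarrow> _")
    and theta_eq_theta_re: "theta q x = of_real (theta_re q x)"
    and theta_re_pos: "0 < theta_re q x"
proof -
  have Q: "0 < q\<^sup>2" "q\<^sup>2 < 1" using q by (auto simp: power_less_one_iff)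
  note L = qlim_pos[OF Q]
  have "x \<noteq> 0" using x by auto
  from jacobi_triple_product[OF q this]
  have lim: "(\<lambda>n. of_real (?P n)) \<longlonglongrightarrow> theta q x / of_real (qlim (q\<^sup>2))"
    unfolding one_plus_mult_cnj[OF x] of_real_prod[symmetric] .
  from tendsto_Re[OF this] show 1: "?P \<longlonglongrightarrow> theta_re q x / qlim (q\<^sup>2)"
    by (simp only: Re_divide_of_real Re_complex_of_real theta_re_def)
  have "(\<lambda>n. Im (of_real (?P n))) \<longlonglongrightarrow> Im (theta q x / of_real (qlim (q\<^sup>2)))"
    by (rule tendsto_Im[OF lim])
  then have "(\<lambda>n. 0) \<longlonglongrightarrow> Im (theta q x) / qlim (q\<^sup>2)"
    by (simp only: Im_divide_of_real Im_complex_of_real)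
  then have "Im (theta q x) / qlim (q\<^sup>2) = 0" by (rule LIMSEQ_unique) simp
  then show "theta q x = of_real (theta_re q x)"
    using L by (simp add: theta_re_def complex_eq_iff)
  \<comment> \<open>A positive lower bound common to all partial products: the limit of positive
    numbers alone could be 0, and theta has to serve as a denominator.\<close>
  have "(exp (- (1 / (1 - q)\<^sup>2)))\<^sup>2 \<le> theta_re q x / qlim (q\<^sup>2)"
  proof (rule LIMSEQ_le_const[OF 1], intro exI allI impI)
    fix n
    have "exp (- (1 / (1 - q)\<^sup>2)) \<le> (\<Prod>k<n. 1 - q ^ (2 * k + 1))"
      using q by (intro prod_one_minus_lower_bound) (auto intro: power_decreasing simp del: power_Suc)
    also have "\<dots> \<le> (\<Prod>k<n. norm (1 + x * of_real (q ^ (2 * k + 1))))"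
      using odd_power_less_1[OF q]
      by (intro prod_mono conjI norm_one_plus_bounds(1)[OF x]) (auto intro: less_imp_le simp del: power_Suc)
    finally have "(exp (- (1 / (1 - q)\<^sup>2)))\<^sup>2 \<le> (\<Prod>k<n. norm (1 + x * of_real (q ^ (2 * k + 1))))\<^sup>2"
      by (intro power_mono) auto
    then show "(exp (- (1 / (1 - q)\<^sup>2)))\<^sup>2 \<le> ?P n" by (simp only: prod_power_distrib)
  qed
  then have "0 < theta_re q x / qlim (q\<^sup>2)" by (meson exp_gt_zero less_le_trans zero_less_power)
  then show "0 < theta_re q x" using L by (simp add: zero_less_divide_iff)
qed

definition theta_quot :: "real \<Rightarrow> complex \<Rightarrow> real" where
  "theta_quot q x = theta_re q x / theta_re q (- x)"

text \<open>The modulus of theta_1 / theta_4 of nome q^2 for |u| = 1, divided by its natural factor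
  q^(1/2). Two such factors account for the q in \<open>theta_quot_cross_ratio\<close>.\<close>

definition theta_ratio :: "real \<Rightarrow> complex \<Rightarrow> real" where
  "theta_ratio q u = norm (theta (q\<^sup>2) (- (of_real (q\<^sup>2) * u))) / norm (theta (q\<^sup>2) (- u))"

context
  fixes q :: real
  assumes q: "0 < q" "q < 1"
begin

lemma theta_quot_pos: "norm x = 1 \<Longrightarrow> 0 < theta_quot q x"
  using theta_re_pos[OF q, of x] theta_re_pos[OF q, of "- x"] by (simp add: theta_quot_def)

lemma theta_quot_tendsto:
  assumes x: "norm x = 1"
  shows "(\<lambda>n. \<Prod>k<n. (norm (1 + x * of_real (q ^ (2 * k + 1))) / norm (1 - x * of_real (q ^ (2 * k + 1))))\<^sup>2)
           \<longlonglongrightarrow> theta_quot q x"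
proof -
  have Q: "0 < q\<^sup>2" "q\<^sup>2 < 1" using q by (auto simp: power_less_one_iff)
  note L = qlim_pos[OF Q]
  have mx: "norm (- x) = 1" using x by simp
  have "theta_re q (- x) / qlim (q\<^sup>2) \<noteq> 0"
    using theta_re_pos[OF q mx] L by simp
  from tendsto_divide[OF theta_re_tendsto(1)[OF q x] theta_re_tendsto(1)[OF q mx] this]
  show ?thesis using L
    by (simp only: theta_quot_def prod_dividef power_divide mult_minus_left add_uminus_conv_diff) simp
qed

lemma norm_ratio_le:
  fixes x :: complex
  assumes x: "norm x = 1" and p: "0 \<le> p" "p < 1"
  shows "norm (1 + x * of_real p) / norm (1 - x * of_real p) \<le> (1 + p) / (1 - p)"
  using norm_one_plus_bounds[of x p] norm_one_plus_bounds[of "- x" p] assms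
  by (intro frac_le) auto

lemma theta_quot_one_tendsto:
  "(\<lambda>n. \<Prod>k<n. ((1 + q ^ (2 * k + 1)) / (1 - q ^ (2 * k + 1)))\<^sup>2) \<longlonglongrightarrow> theta_quot q 1"
proof -
  have 1: "norm (1 + 1 * complex_of_real p) = 1 + p" and 2: "norm (1 - 1 * complex_of_real p) = 1 - p"
    if "0 \<le> p" "p < 1" for p
  proof -
    have "1 + 1 * complex_of_real p = of_real (1 + p)" "1 - 1 * complex_of_real p = of_real (1 - p)" by simp_all
    then show "norm (1 + 1 * complex_of_real p) = 1 + p" "norm (1 - 1 * complex_of_real p) = 1 - p"
      using that by (simp_all only: norm_of_real)
  qed
  show ?thesis
    using theta_quot_tendsto[of 1] unfolding 1[OF odd_power_less_1[OF q]] 2[OF odd_power_less_1[OF q]] by simp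
qed

lemma theta_quot_minus: "theta_quot q (- x) = 1 / theta_quot q x"
  by (simp add: theta_quot_def)

text \<open>Holds factor by factor, since |1 + x p| / |1 - x p| is largest at x = 1. Because x and
  -x give reciprocal quotients, all values lie between 1 / M and M, with M the value at 1.\<close>

lemma theta_quot_le_one:
  assumes x: "norm x = 1"
  shows "theta_quot q x \<le> theta_quot q 1"
proof (rule LIMSEQ_le[OF theta_quot_tendsto[OF x] theta_quot_one_tendsto], intro exI allI impI)
  fix n
  show "(\<Prod>k<n. (norm (1 + x * of_real (q ^ (2 * k + 1))) / norm (1 - x * of_real (q ^ (2 * k + 1))))\<^sup>2)
      \<le> (\<Prod>k<n. ((1 + q ^ (2 * k + 1)) / (1 - q ^ (2 * k + 1)))\<^sup>2)"
    by (intro prod_mono conjI power_mono norm_ratio_le[OF x] odd_power_less_1[OF q]) auto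
qed

lemma theta_quot_ge:
  assumes x: "norm x = 1"
  shows "1 / theta_quot q 1 \<le> theta_quot q x"
proof -
  have "1 / theta_quot q x \<le> theta_quot q 1"
    using theta_quot_le_one[of "- x"] x by (simp add: theta_quot_minus)
  then show ?thesis
    using theta_quot_pos[OF x] theta_quot_pos[of 1] by (simp add: field_simps)
qed

text \<open>Clearing the denominators leaves the left-hand sides of \<open>theta_diff\<close> and
  \<open>theta_sum\<close>; the prefactors 2 q x and 2 have a quotient of modulus q.\<close>

lemma theta_quot_cross_ratio:
  assumes x: "norm x = 1" and y: "norm y = 1"
  shows "\<bar>(theta_quot q x - theta_quot q y) / (theta_quot q x + theta_quot q y)\<bar>
    = q * (theta_ratio q (x * y) * theta_ratio q (x / y))"
proof -
  let ?c = "theta_re q (- x) * theta_re q (- y)"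
  let ?d = "theta_re q x * theta_re q (- y) - theta_re q (- x) * theta_re q y"
  let ?s = "theta_re q x * theta_re q (- y) + theta_re q (- x) * theta_re q y"
  have nz: "x \<noteq> 0" "y \<noteq> 0" using x y by auto
  have n: "norm (- x) = 1" "norm (- y) = 1" using x y by auto
  note pos = theta_re_pos[OF q x] theta_re_pos[OF q y] theta_re_pos[OF q n(1)] theta_re_pos[OF q n(2)]
  note eq = theta_eq_theta_re[OF q x] theta_eq_theta_re[OF q y] theta_eq_theta_re[OF q n(1)] theta_eq_theta_re[OF q n(2)]
  have "theta_quot q x - theta_quot q y = ?d / ?c" "theta_quot q x + theta_quot q y = ?s / ?c"
    using pos by (simp_all add: theta_quot_def field_simps)
  then have "(theta_quot q x - theta_quot q y) / (theta_quot q x + theta_quot q y) = ?d / ?s"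
    using pos by simp
  then have "\<bar>(theta_quot q x - theta_quot q y) / (theta_quot q x + theta_quot q y)\<bar>
      = norm (of_real ?d :: complex) / norm (of_real ?s :: complex)"
    by (simp only: norm_of_real abs_divide)
  also have "(of_real ?d :: complex) = 2 * of_real q * x * (theta (q\<^sup>2) (- (of_real (q\<^sup>2) * (x * y))) * theta (q\<^sup>2) (- (of_real (q\<^sup>2) * (x / y))))"
    unfolding theta_diff[OF q nz, symmetric] eq by simp
  also have "(of_real ?s :: complex) = 2 * (theta (q\<^sup>2) (- (x * y)) * theta (q\<^sup>2) (- (x / y)))"
    unfolding theta_sum[OF q nz, symmetric] eq by simp
  finally show ?thesis
    using q x by (simp only: theta_ratio_def norm_mult norm_of_real) (simp add: mult_ac)
qed

text \<open>The triple product for nome q^2 at - q^2 u and at - u. The first shifts the exponents by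
  two, so its inverse powers start with 1 - 1 / u, the zero of theta_1; the normalising constants
  cancel.\<close>

lemma theta_ratio_tendsto:
  assumes u: "norm u = 1"
  shows "(\<lambda>n. \<Prod>k<n. norm ((1 - u * of_real (q ^ (4 * k + 4))) * (1 - of_real (q ^ (4 * k)) / u)
          / ((1 - u * of_real (q ^ (4 * k + 2))) * (1 - of_real (q ^ (4 * k + 2)) / u)))) \<longlonglongrightarrow> theta_ratio q u"
proof -
  have Q: "0 < q\<^sup>2" "q\<^sup>2 < 1" using q by (auto simp: power_less_one_iff)
  have Q2: "0 < (q\<^sup>2)\<^sup>2" "(q\<^sup>2)\<^sup>2 < 1" using square_unit_interval[OF Q] by auto
  note L = qlim_pos[OF Q2]
  have u0: "u \<noteq> 0" and nu: "norm (- u) = 1" using u by auto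
  have q0: "(of_real q :: complex) \<noteq> 0" using q by simp
  define v where "v = - (of_real (q\<^sup>2) * u)"
  have v0: "v \<noteq> 0" using u0 q by (simp add: v_def)
  have e1: "(1 + v * of_real ((q\<^sup>2) ^ (2 * k + 1))) * (1 + of_real ((q\<^sup>2) ^ (2 * k + 1)) / v)
     = (1 - u * of_real (q ^ (4 * k + 4))) * (1 - of_real (q ^ (4 * k)) / u)" for k
  proof -
    have "(q\<^sup>2) ^ (2 * k + 1) = q ^ (2 * (2 * k + 1))" by (rule power_mult[symmetric])
    also have "2 * (2 * k + 1) = 4 * k + 2" by simp
    also have "q ^ (4 * k + 2) = q ^ (4 * k) * q\<^sup>2" by (rule power_add)
    finally have a: "(q\<^sup>2) ^ (2 * k + 1) = q ^ (4 * k) * q\<^sup>2" .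
    have b: "q ^ (4 * k + 4) = q ^ (4 * k) * q\<^sup>2 * q\<^sup>2"
      by (simp add: power_add power4_eq_xxxx power2_eq_square mult.assoc)
    show ?thesis unfolding a b v_def using q0 u0 by (simp add: field_simps)
  qed
  have e2: "(1 + (- u) * of_real ((q\<^sup>2) ^ (2 * k + 1))) * (1 + of_real ((q\<^sup>2) ^ (2 * k + 1)) / (- u))
     = (1 - u * of_real (q ^ (4 * k + 2))) * (1 - of_real (q ^ (4 * k + 2)) / u)" for k
  proof -
    have a: "(q\<^sup>2) ^ (2 * k + 1) = q ^ (4 * k + 2)"
      by (simp add: power_mult[symmetric] power_add[symmetric])
    show ?thesis unfolding a by simp
  qed
  have "theta (q\<^sup>2) (- u) / of_real (qlim ((q\<^sup>2)\<^sup>2)) \<noteq> 0"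
    using theta_eq_theta_re[OF Q nu] theta_re_pos[OF Q nu] L by simp
  moreover have "- u \<noteq> 0" using u0 by simp
  ultimately have "(\<lambda>n. norm ((\<Prod>k<n. (1 - u * of_real (q ^ (4 * k + 4))) * (1 - of_real (q ^ (4 * k)) / u))
       / (\<Prod>k<n. (1 - u * of_real (q ^ (4 * k + 2))) * (1 - of_real (q ^ (4 * k + 2)) / u))))
     \<longlonglongrightarrow> norm ((theta (q\<^sup>2) v / of_real (qlim ((q\<^sup>2)\<^sup>2))) / (theta (q\<^sup>2) (- u) / of_real (qlim ((q\<^sup>2)\<^sup>2))))"
    using jacobi_triple_product[OF Q v0, unfolded e1] jacobi_triple_product[OF Q _, of "- u", unfolded e2]
    by (intro tendsto_intros)
  then show ?thesis
    using L by (simp only: prod_dividef prod_norm) (simp add: theta_ratio_def v_def norm_divide)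
qed

end

text \<open>The 2l-th roots of -1 in the upper half plane, for i < l. As exp(2 i w) they encode
  equally spaced nodes w; together with their inverses they exhaust the 2l roots.\<close>

definition minus_one_root :: "nat \<Rightarrow> nat \<Rightarrow> complex" where
  "minus_one_root l i = cis (real (2 * i + 1) * pi / real (2 * l))"

lemma norm_minus_one_root [simp]: "norm (minus_one_root l i) = 1"
  by (simp add: minus_one_root_def)

lemma prod_roots_of_minus_one:
  fixes x :: complex
  assumes "N > 0"
  shows "(\<Prod>w | w ^ N = - 1. x - w) = x ^ N + 1"
proof -
  define p :: "complex poly" where "p = monom 1 N + 1"
  have ev: "poly p a = a ^ N + 1" for a by (simp add: p_def poly_monom)
  have "rsquarefree p"
    unfolding rsquarefree_roots
  proof (intro allI notI)
    fix a assume a: "poly p a = 0 \<and> poly (pderiv p) a = 0"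
    then have "of_nat N * a ^ (N - 1) = 0"
      by (simp add: p_def pderiv_add pderiv_monom poly_monom)
    then have "a = 0" using assms by simp
    then show False using a assms by (simp add: ev power_0_left)
  qed
  have "degree p = N"
    unfolding p_def using assms by (subst degree_add_eq_left) (auto simp: degree_monom_eq)
  then have "lead_coeff p = 1" using assms by (simp add: p_def)
  have "p = (\<Prod>z|poly p z = 0. [:-z, 1:])"
    using complex_poly_decompose_rsquarefree[OF \<open>rsquarefree p\<close>] \<open>lead_coeff p = 1\<close> by simp
  then have "poly p x = poly (\<Prod>z|poly p z = 0. [:-z, 1:]) x" by (rule arg_cong)
  then have "poly p x = (\<Prod>z|poly p z = 0. x - z)" by (simp add: poly_prod)
  moreover have "{z. poly p z = 0} = {w. w ^ N = - 1}"
    by (auto simp: ev eq_neg_iff_add_eq_0)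
  ultimately show ?thesis by (simp add: ev)
qed

text \<open>The l listed points are distinct by injectivity of the cosine on [0, pi], and separated
  from their conjugates by the sign of the imaginary part. These 2l solutions are all, by
  counting.\<close>

lemma minus_one_roots:
  assumes l: "l > 0"
  shows "{w. w ^ (2 * l) = - 1} = minus_one_root l ` {..<l} \<union> (\<lambda>i. cnj (minus_one_root l i)) ` {..<l}"
    and "inj_on (minus_one_root l) {..<l}"
    and "minus_one_root l ` {..<l} \<inter> (\<lambda>i. cnj (minus_one_root l i)) ` {..<l} = {}"
proof -
  let ?a = "\<lambda>i. real (2 * i + 1) * pi / real (2 * l)"
  have a: "0 < ?a i" "?a i < pi" if "i < l" for i
  proof -
    show "0 < ?a i" using l by simp
    have "real (2 * i + 1) < real (2 * l)" using that by (simp only: of_nat_less_iff)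
    then have "real (2 * i + 1) * pi < real (2 * l) * pi" by (intro mult_strict_right_mono) auto
    then show "?a i < pi" using l by (simp only: divide_less_eq) (simp add: mult.commute)
  qed
  show inj: "inj_on (minus_one_root l) {..<l}"
  proof (rule inj_onI)
    fix i k assume "i \<in> {..<l}" "k \<in> {..<l}" and eq: "minus_one_root l i = minus_one_root l k"
    then have "i < l" "k < l" by auto
    note ai = a[OF this(1)] and ak = a[OF this(2)]
    have "cos (?a i) = cos (?a k)"
      using arg_cong[OF eq, of Re] by (simp add: minus_one_root_def)
    then have "?a i = ?a k"
      by (rule cos_inj_pi[rotated 4]) (use ai ak in auto)
    then show "i = k" using l by simp
  qed
  have im: "Im (minus_one_root l i) > 0" if "i < l" for i
    using sin_gt_zero[OF a(1)[OF that] a(2)[OF that]] by (simp add: minus_one_root_def)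
  show disj: "minus_one_root l ` {..<l} \<inter> (\<lambda>i. cnj (minus_one_root l i)) ` {..<l} = {}"
  proof (rule ccontr)
    assume "\<not> ?thesis"
    then obtain i k where "i < l" "k < l" "minus_one_root l i = cnj (minus_one_root l k)" by auto
    with im[of i] im[of k] show False by simp
  qed
  have root: "minus_one_root l i ^ (2 * l) = - 1" for i
  proof -
    have "minus_one_root l i ^ (2 * l) = cis (real (2 * l) * ?a i)"
      unfolding minus_one_root_def by (rule Complex.DeMoivre)
    also have "real (2 * l) * ?a i = pi + 2 * pi * real i"
      using l by (simp add: field_simps)
    also have "cis (pi + 2 * pi * real i) = - 1"
      by (simp only: cis_mult[symmetric] cis_multiple_2pi[OF Ints_of_nat] cis_pi mult_1_right)
    finally show ?thesis .
  qed
  then have rootc: "cnj (minus_one_root l i) ^ (2 * l) = - 1" for i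
    by (metis complex_cnj_minus complex_cnj_one complex_cnj_power)
  have "finite {w :: complex. w ^ (2 * l) = - 1}" using l by (intro finite_nth_roots) auto
  moreover have "minus_one_root l ` {..<l} \<union> (\<lambda>i. cnj (minus_one_root l i)) ` {..<l} \<subseteq> {w. w ^ (2 * l) = - 1}"
    using root rootc by auto
  moreover have "card (minus_one_root l ` {..<l} \<union> (\<lambda>i. cnj (minus_one_root l i)) ` {..<l}) = card {w :: complex. w ^ (2 * l) = - 1}"
  proof -
    have "inj_on (\<lambda>i. cnj (minus_one_root l i)) {..<l}"
      using inj by (simp add: inj_on_def)
    then have "card (minus_one_root l ` {..<l} \<union> (\<lambda>i. cnj (minus_one_root l i)) ` {..<l}) = l + l"
      by (subst card_Un_disjoint) (simp_all add: disj card_image inj)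
    then show ?thesis using l by (simp add: card_nth_roots)
  qed
  ultimately show "{w. w ^ (2 * l) = - 1} = minus_one_root l ` {..<l} \<union> (\<lambda>i. cnj (minus_one_root l i)) ` {..<l}"
    by (intro card_subset_eq[symmetric])
qed

text \<open>Inverses of these roots are their conjugates, so the paired factors run through all 2l
  roots; at 1 / z this is the factorisation of the polynomial w^(2l) + 1.\<close>

lemma prod_minus_one_roots:
  assumes l: "l > 0"
  shows "(\<Prod>i<l. (1 - z * minus_one_root l i) * (1 - z / minus_one_root l i)) = 1 + z ^ (2 * l)"
proof (cases "z = 0")
  case True
  then show ?thesis using l by (simp add: power_0_left)
next
  case False
  note roots = minus_one_roots[OF l]
  have inv: "1 / minus_one_root l i = cnj (minus_one_root l i)" for i
    by (simp add: divide_conv_cnj)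
  have injc: "inj_on (\<lambda>i. cnj (minus_one_root l i)) {..<l}"
    using roots(2) by (simp add: inj_on_def)
  have "(\<Prod>i<l. (1 - z * minus_one_root l i) * (1 - z / minus_one_root l i))
    = (\<Prod>i<l. (z * z) * ((1 / z - minus_one_root l i) * (1 / z - cnj (minus_one_root l i))))"
    unfolding inv[symmetric] using False by (intro prod.cong) (auto simp: field_simps)
  also have "\<dots> = z ^ (2 * l) * ((\<Prod>i<l. 1 / z - minus_one_root l i) * (\<Prod>i<l. 1 / z - cnj (minus_one_root l i)))"
    by (simp add: prod.distrib power_mult power2_eq_square)
  also have "(\<Prod>i<l. 1 / z - minus_one_root l i) * (\<Prod>i<l. 1 / z - cnj (minus_one_root l i)) = (\<Prod>w | w ^ (2 * l) = - 1. 1 / z - w)"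
    unfolding roots(1) by (subst prod.union_disjoint)
      (simp_all add: roots(3) prod.reindex[OF roots(2)] prod.reindex[OF injc])
  also have "\<dots> = (1 / z) ^ (2 * l) + 1"
    using l by (intro prod_roots_of_minus_one) simp
  finally show ?thesis using False by (simp only: power_divide distrib_left) simp
qed

context
  fixes q :: real
  assumes q: "0 < q" "q < 1"
begin

text \<open>All factors are positive at u = -1. The products of 1 + q^(4k) and of 1 + q^(4k+4)
  differ by an index shift, and the factor 1 + q^0 left over is the constant 2; what remains is at
  most 1.\<close>

lemma theta_ratio_minus_one_le: "theta_ratio q (- 1) \<le> 2"
proof (rule LIMSEQ_le_const2[OF theta_ratio_tendsto[OF q]], simp, intro exI allI impI)
  fix n
  have factor: "norm ((1 - (- 1) * complex_of_real (q ^ (4 * k + 4))) * (1 - of_real (q ^ (4 * k)) / (- 1))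
          / ((1 - (- 1) * of_real (q ^ (4 * k + 2))) * (1 - of_real (q ^ (4 * k + 2)) / (- 1))))
     = (1 + q ^ (4 * k + 4)) * (1 + q ^ (4 * k)) / (1 + q ^ (4 * k + 2))\<^sup>2" (is "norm ?z = ?r") for k
  proof -
    have "?z = of_real ?r" by (simp add: power2_eq_square)
    then show ?thesis using q by (simp only: norm_of_real) simp
  qed
  have tele: "(\<Prod>k<n. 1 + q ^ (4 * k)) * (1 + q ^ (4 * n)) = 2 * (\<Prod>k<n. 1 + q ^ (4 * k + 4))"
  proof (induction n)
    case (Suc n)
    have "4 * Suc n = 4 * n + 4" by simp
    then show ?case unfolding prod.lessThan_Suc Suc.IH by (simp only: mult.assoc)
  qed simp
  have "(\<Prod>k<n. 1 + q ^ (4 * k)) * 1 \<le> (\<Prod>k<n. 1 + q ^ (4 * k)) * (1 + q ^ (4 * n))"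
    using q by (intro mult_left_mono prod_nonneg) auto
  then have 1: "(\<Prod>k<n. 1 + q ^ (4 * k)) \<le> 2 * (\<Prod>k<n. 1 + q ^ (4 * k + 4))"
    unfolding tele by simp
  have 2: "(\<Prod>k<n. 1 + q ^ (4 * k + 4)) \<le> (\<Prod>k<n. 1 + q ^ (4 * k + 2))"
  proof (intro prod_mono conjI add_left_mono)
    fix k
    show "q ^ (4 * k + 4) \<le> q ^ (4 * k + 2)" using q by (intro power_decreasing) auto
    show "0 \<le> 1 + q ^ (4 * k + 4)" using q by (intro add_nonneg_nonneg) auto
  qed
  have P: "(\<Prod>k<n. 1 + q ^ (4 * k + 4)) \<ge> 0" "(\<Prod>k<n. 1 + q ^ (4 * k + 2)) > 0"
    using q by (auto intro!: prod_nonneg prod_pos add_pos_nonneg)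
  have "(\<Prod>k<n. 1 + q ^ (4 * k + 4)) * (\<Prod>k<n. 1 + q ^ (4 * k)) \<le> (\<Prod>k<n. 1 + q ^ (4 * k + 2)) * (2 * (\<Prod>k<n. 1 + q ^ (4 * k + 2)))"
    using 1 2 P q by (intro mult_mono order_trans[OF 1] prod_nonneg) auto
  then have "(\<Prod>k<n. 1 + q ^ (4 * k + 4)) * (\<Prod>k<n. 1 + q ^ (4 * k)) / (\<Prod>k<n. 1 + q ^ (4 * k + 2))\<^sup>2 \<le> 2"
    using P by (simp add: divide_le_eq power2_eq_square mult_ac)
  then show "(\<Prod>k<n. norm ((1 - (- 1) * complex_of_real (q ^ (4 * k + 4))) * (1 - of_real (q ^ (4 * k)) / (- 1))
          / ((1 - (- 1) * of_real (q ^ (4 * k + 2))) * (1 - of_real (q ^ (4 * k + 2)) / (- 1))))) \<le> 2"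
    unfolding factor by (simp only: prod_dividef prod.distrib prod_power_distrib[symmetric])
qed

text \<open>\<open>q (theta_ratio q u)\<^sup>2\<close> is the cross ratio of \<open>theta_quot q u\<close> with the maximal value
  \<open>M = theta_quot q 1\<close>, which is largest where \<open>theta_quot\<close> attains its minimum \<open>1 / M\<close>, at \<open>u = -1\<close>.\<close>

lemma theta_ratio_le_2:
  assumes u: "norm u = 1"
  shows "theta_ratio q u \<le> 2"
proof -
  define M where "M = theta_quot q 1"
  have M: "M > 0" unfolding M_def by (rule theta_quot_pos[OF q]) simp
  have nn: "theta_ratio q z \<ge> 0" for z by (simp add: theta_ratio_def)
  have sq: "q * (theta_ratio q z)\<^sup>2 = (M - theta_quot q z) / (M + theta_quot q z)" if z: "norm z = 1" for z
  proof -
    have "\<bar>(theta_quot q z - M) / (theta_quot q z + M)\<bar> = q * (theta_ratio q z)\<^sup>2"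
      using theta_quot_cross_ratio[OF q z, of 1] by (simp add: M_def power2_eq_square)
    moreover from z have "theta_quot q z \<le> M" "theta_quot q z > 0"
      using theta_quot_le_one[OF q z] theta_quot_pos[OF q z] by (auto simp: M_def)
    then have "\<bar>(theta_quot q z - M) / (theta_quot q z + M)\<bar> = (M - theta_quot q z) / (M + theta_quot q z)"
      using M by (simp add: abs_divide add.commute)
    ultimately show ?thesis by simp
  qed
  have m1: "theta_quot q (- 1) = 1 / M"
    using theta_quot_minus[OF q, of 1] by (simp add: M_def)
  have "q * (theta_ratio q u)\<^sup>2 \<le> q * (theta_ratio q (- 1))\<^sup>2"
  proof -
    have F: "1 / M \<le> theta_quot q u" "theta_quot q u > 0" "theta_quot q u \<le> M"
      using theta_quot_ge[OF q u] theta_quot_pos[OF q u] theta_quot_le_one[OF q u] by (auto simp: M_def)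
    have "(M - theta_quot q u) / (M + theta_quot q u) \<le> (M - 1 / M) / (M + 1 / M)"
      using F M by (intro frac_le) (auto intro: add_pos_pos)
    then show ?thesis using sq[OF u] sq[of "- 1"] m1 by simp
  qed
  then have "(theta_ratio q u)\<^sup>2 \<le> (theta_ratio q (- 1))\<^sup>2" using q by simp
  then have "theta_ratio q u \<le> theta_ratio q (- 1)"
    by (rule power2_le_imp_le) (rule nn)
  with theta_ratio_minus_one_le show ?thesis by linarith
qed

text \<open>For each k the factors over all nodes collapse, by \<open>prod_minus_one_roots\<close>,
  into a binomial in 2l-th powers. This is again a factor of the product for
  \<open>theta_ratio\<close>, with q and x replaced by their powers and the sign coming from the
  roots of -1.\<close>

lemma prod_theta_ratio:
  assumes l: "l > 0" and x: "norm x = 1"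
  shows "(\<Prod>i<l. theta_ratio q (x * minus_one_root l i) * theta_ratio q (x / minus_one_root l i))
    = theta_ratio (q ^ (2 * l)) (- (x ^ (2 * l)))"
proof -
  let ?y = "minus_one_root l" and ?N = "2 * l"
  define g where "g = (\<lambda>r k u. norm ((1 - u * complex_of_real (r ^ (4 * k + 4))) * (1 - of_real (r ^ (4 * k)) / u)
          / ((1 - u * of_real (r ^ (4 * k + 2))) * (1 - of_real (r ^ (4 * k + 2)) / u))))"
  have x0: "x \<noteq> 0" using x by auto
  have y0: "?y i \<noteq> 0" for i by (metis norm_minus_one_root norm_zero zero_neq_one)
  have pw: "complex_of_real ((q ^ ?N) ^ m) = of_real (q ^ m) ^ ?N" for m
    by (simp add: power_mult[symmetric] mult.commute)
  have qN: "0 < q ^ ?N" "q ^ ?N < 1" using q l by (auto simp: power_less_one_iff)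
  have lim1: "(\<lambda>n. \<Prod>k<n. g q k u) \<longlonglongrightarrow> theta_ratio q u" if "norm u = 1" for u
    using theta_ratio_tendsto[OF q that] by (simp only: g_def)
  have factor: "(\<Prod>i<l. (1 - (x * ?y i) * c) * (1 - (x / ?y i) * c)) = 1 + x ^ ?N * c ^ ?N"
    "(\<Prod>i<l. (1 - c / (x * ?y i)) * (1 - c / (x / ?y i))) = 1 + c ^ ?N / x ^ ?N" for c
    using prod_minus_one_roots[OF l, of "x * c"] prod_minus_one_roots[OF l, of "c / x"] x0 y0
    by (simp_all add: power_mult_distrib power_divide mult_ac)
  have step: "(\<Prod>i<l. g q k (x * ?y i) * g q k (x / ?y i)) = g (q ^ ?N) k (- (x ^ ?N))" for k
  proof -
    let ?A = "\<lambda>c. \<Prod>i<l. (1 - (x * ?y i) * c) * (1 - (x / ?y i) * c)"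
    let ?B = "\<lambda>c. \<Prod>i<l. (1 - c / (x * ?y i)) * (1 - c / (x / ?y i))"
    let ?c = "\<lambda>m. complex_of_real (q ^ (4 * k + m))"
    have "(\<Prod>i<l. g q k (x * ?y i) * g q k (x / ?y i)) = norm (?A (?c 4) * ?B (?c 0) / (?A (?c 2) * ?B (?c 2)))"
      unfolding g_def norm_mult[symmetric] prod_norm prod.distrib[symmetric] prod_dividef[symmetric]
      by (intro arg_cong[where f = norm] prod.cong refl) (simp add: mult_ac)
    also have "\<dots> = g (q ^ ?N) k (- (x ^ ?N))"
      unfolding factor g_def pw by simp
    finally show ?thesis .
  qed
  have "(\<lambda>n. \<Prod>i<l. (\<Prod>k<n. g q k (x * ?y i)) * (\<Prod>k<n. g q k (x / ?y i)))
     \<longlonglongrightarrow> (\<Prod>i<l. theta_ratio q (x * ?y i) * theta_ratio q (x / ?y i))"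
    using x by (intro tendsto_intros lim1) (simp_all add: norm_mult norm_divide)
  also have "(\<lambda>n. \<Prod>i<l. (\<Prod>k<n. g q k (x * ?y i)) * (\<Prod>k<n. g q k (x / ?y i)))
      = (\<lambda>n. \<Prod>k<n. g (q ^ ?N) k (- (x ^ ?N)))"
    unfolding step[symmetric] prod.distrib[symmetric] by (intro ext prod.swap)
  finally have "(\<lambda>n. \<Prod>k<n. g (q ^ ?N) k (- (x ^ ?N))) \<longlonglongrightarrow> (\<Prod>i<l. theta_ratio q (x * ?y i) * theta_ratio q (x / ?y i))" .
  moreover have "(\<lambda>n. \<Prod>k<n. g (q ^ ?N) k (- (x ^ ?N))) \<longlonglongrightarrow> theta_ratio (q ^ ?N) (- (x ^ ?N))"
    unfolding g_def using x by (intro theta_ratio_tendsto qN) (simp add: norm_power)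
  ultimately show ?thesis by (rule LIMSEQ_unique)
qed

end

lemma theta_quot_blaschke_le:
  assumes q: "0 < q" "q < 1" and x: "norm x = 1"
  shows "(\<Prod>i<l. \<bar>(theta_quot q x - theta_quot q (minus_one_root l i)) / (theta_quot q x + theta_quot q (minus_one_root l i))\<bar>) \<le> 2 * q ^ l"
proof (cases "l = 0")
  case False
  then have l: "l > 0" by simp
  have qN: "0 < q ^ (2 * l)" "q ^ (2 * l) < 1" using q l by (auto simp: power_less_one_iff)
  have "(\<Prod>i<l. \<bar>(theta_quot q x - theta_quot q (minus_one_root l i)) / (theta_quot q x + theta_quot q (minus_one_root l i))\<bar>)
     = q ^ l * theta_ratio (q ^ (2 * l)) (- (x ^ (2 * l)))"
    by (simp only: theta_quot_cross_ratio[OF q x norm_minus_one_root] prod.distrib[of "\<lambda>_. q"]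
        prod_theta_ratio[OF q l x] prod_constant card_lessThan)
  also have "\<dots> \<le> q ^ l * 2"
    using q x by (intro mult_left_mono theta_ratio_le_2[OF qN]) (auto simp: norm_power)
  finally show ?thesis by simp
qed simp

section \<open>Values of the theta quotient on the unit circle\<close>

lemma continuous_theta_cis:
  assumes q: "0 < q" "q < 1"
  shows "continuous_on UNIV (\<lambda>t. theta q (c * cis t))"
proof -
  have "uniform_limit UNIV (\<lambda>n t. \<Sum>j<n. theta_term (of_real q) (c * cis t) j) (\<lambda>t. \<Sum>j. theta_term (of_real q) (c * cis t) j) sequentially"
  proof (rule Weierstrass_m_test)
    show "summable (\<lambda>j. q ^ (j * j) * norm c ^ j + q ^ (j * j) * norm (inverse c) ^ j)"
      by (intro summable_add summable_gaussian_power q) auto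
    fix j t
    show "norm (theta_term (of_real q) (c * cis t) j) \<le> q ^ (j * j) * norm c ^ j + q ^ (j * j) * norm (inverse c) ^ j"
    proof (cases "j = 0")
      case False
      have "norm (theta_term (of_real q) (c * cis t) j) = q ^ (j * j) * norm ((c * cis t) ^ j + inverse (c * cis t) ^ j)"
        using False q by (simp add: theta_term_def norm_mult norm_power)
      also have "\<dots> \<le> q ^ (j * j) * (norm ((c * cis t) ^ j) + norm (inverse (c * cis t) ^ j))"
        using q by (intro mult_left_mono norm_triangle_ineq) auto
      finally show ?thesis by (simp add: norm_power norm_mult norm_inverse distrib_left)
    qed (simp add: theta_term_def)
  qed
  moreover have "continuous_on UNIV (\<lambda>t. \<Sum>j<n. theta_term (of_real q) (c * cis t) j)" for n
  proof (intro continuous_on_sum)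
    fix j
    have "theta_term (of_real q) (c * cis t) j = (if j = 0 then 1 else of_real q ^ (j * j) * ((c * cis t) ^ j + (inverse c * cis (- t)) ^ j))" for t
      by (simp only: theta_term_def inverse_mult_distrib cis_inverse)
    then show "continuous_on UNIV (\<lambda>t. theta_term (of_real q) (c * cis t) j)"
      by (cases "j = 0") (auto intro!: continuous_intros simp: cis_conv_exp)
  qed
  ultimately show ?thesis
    unfolding theta_def by (intro uniform_limit_theorem[where F = sequentially]) auto
qed

text \<open>Along the upper half circle the quotient passes continuously from its maximum at 1 to
  the reciprocal value at -1.\<close>

lemma theta_quot_surj:
  assumes q: "0 < q" "q < 1" and t: "1 / theta_quot q 1 \<le> t" "t \<le> theta_quot q 1"
  obtains x where "norm x = 1" "theta_quot q x = t"
proof -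
  have "continuous_on UNIV (\<lambda>t. theta_quot q (cis t))"
    unfolding theta_quot_def theta_re_def
  proof (intro continuous_intros ballI)
    show "continuous_on UNIV (\<lambda>t. theta q (cis t))" using continuous_theta_cis[OF q, of 1] by simp
    show "continuous_on UNIV (\<lambda>t. theta q (- cis t))" using continuous_theta_cis[OF q, of "- 1"] by simp
    show "Re (theta q (- cis s)) \<noteq> 0" for s
      using theta_re_pos[OF q, of "- cis s"] by (simp add: theta_re_def)
  qed
  then have "continuous_on {0..pi} (\<lambda>t. theta_quot q (cis t))"
    by (rule continuous_on_subset) simp
  then have "\<exists>s\<ge>0. s \<le> pi \<and> theta_quot q (cis s) = t"
    using t theta_quot_minus[OF q, of 1] by (intro IVT2') auto
  then show ?thesis using that by (metis norm_cis)
qed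

section \<open>The range of the theta quotient\<close>

lemma Digamma_sums:
  fixes z :: complex
  assumes "z \<noteq> 0"
  shows "(\<lambda>k. inverse (of_nat (Suc k)) - inverse (z + of_nat k)) sums (Digamma z + euler_mascheroni)"
  using summable_sums[OF summable_Digamma[OF assms]] by (simp add: Digamma_def)

lemma Digamma_reflection:
  fixes z :: complex
  assumes "z \<notin> \<int>"
  shows "Digamma (1 - z) - Digamma z = of_real pi * cos (of_real pi * z) / sin (of_real pi * z)"
proof -
  let ?s = "sin (of_real pi * z)"
  have z: "z \<notin> \<int>\<^sub>\<le>\<^sub>0" "1 - z \<notin> \<int>\<^sub>\<le>\<^sub>0"
  proof -
    show "z \<notin> \<int>\<^sub>\<le>\<^sub>0" using assms nonpos_Ints_Int by blast
    show "1 - z \<notin> \<int>\<^sub>\<le>\<^sub>0"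
    proof
      assume "1 - z \<in> \<int>\<^sub>\<le>\<^sub>0"
      then have "1 - (1 - z) \<in> \<int>" by (intro Ints_diff Ints_1 nonpos_Ints_Int)
      then show False using assms by simp
    qed
  qed
  have G: "Gamma z * Gamma (1 - z) = of_real pi / ?s" by (rule Gamma_reflection_complex)
  have "Gamma z * Gamma (1 - z) \<noteq> 0" using z by (simp add: Gamma_eq_zero_iff)
  then have s: "?s \<noteq> 0" using G by auto
  have "((\<lambda>w. Gamma w * Gamma (1 - w)) has_field_derivative
      Gamma z * Gamma (1 - z) * (Digamma z - Digamma (1 - z))) (at z)"
    using z by (auto intro!: derivative_eq_intros simp: algebra_simps)
  moreover have "((\<lambda>w. of_real pi / sin (of_real pi * w)) has_field_derivative
      - (of_real pi * (cos (of_real pi * z) * of_real pi)) / (?s * ?s)) (at z)"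
    using s by (auto intro!: derivative_eq_intros)
  ultimately have "Gamma z * Gamma (1 - z) * (Digamma z - Digamma (1 - z))
      = - (of_real pi * (cos (of_real pi * z) * of_real pi)) / (?s * ?s)"
    unfolding Gamma_reflection_complex by (rule DERIV_unique)
  then have "of_real pi / ?s * (Digamma z - Digamma (1 - z)) = of_real pi / ?s * (- (of_real pi * cos (of_real pi * z) / ?s))"
    unfolding G by (simp add: mult_ac)
  then have "Digamma z - Digamma (1 - z) = - (of_real pi * cos (of_real pi * z) / ?s)"
    using s by (subst (asm) mult_left_cancel) auto
  then show ?thesis by (metis minus_diff_eq minus_minus)
qed

text \<open>At z = i x / pi the series of the digamma function at 1 - z and 1 + z differ termwise by
  the wanted fractions, and recurrence and reflection evaluate the difference as a cotangent at an
  imaginary point.\<close>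

lemma coth_partial_fractions:
  fixes x :: real
  assumes x: "x > 0"
  shows "(\<lambda>k. 2 * x / (x\<^sup>2 + (real (Suc k) * pi)\<^sup>2)) sums (cosh x / sinh x - 1 / x)"
proof -
  define y where "y = x / pi"
  define z where "z = \<i> * complex_of_real y"
  have y: "y > 0" using x by (simp add: y_def)
  have zI: "z \<notin> \<int>"
    using y by (auto simp: z_def complex_eq_iff elim!: Ints_cases)
  have z0: "z \<noteq> 0" "1 + z \<noteq> 0" "1 - z \<noteq> 0"
    using y by (auto simp: z_def complex_eq_iff)
  have "(\<lambda>k. \<i> * ((inverse (of_nat (Suc k)) - inverse ((1 - z) + of_nat k)) - (inverse (of_nat (Suc k)) - inverse ((1 + z) + of_nat k))))
     sums (\<i> * ((Digamma (1 - z) + euler_mascheroni) - (Digamma (1 + z) + euler_mascheroni)))"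
    by (intro sums_mult sums_diff Digamma_sums z0)
  also have "\<i> * ((Digamma (1 - z) + euler_mascheroni) - (Digamma (1 + z) + euler_mascheroni))
      = \<i> * (of_real pi * cos (of_real pi * z) / sin (of_real pi * z) - 1 / z)"
    using Digamma_plus1[OF z0(1)] Digamma_reflection[OF zI] by (simp add: algebra_simps)
  also have "\<dots> = of_real (pi * (cosh x / sinh x) - 1 / y)"
  proof -
    have "of_real pi * z = \<i> * complex_of_real x" by (simp add: z_def y_def)
    moreover have "cos (\<i> * complex_of_real x) = of_real (cosh x)"
      by (simp add: cosh_conv_cos[symmetric] cosh_def exp_of_real[symmetric] scaleR_conv_of_real)
    moreover have "sin (\<i> * complex_of_real x) = \<i> * of_real (sinh x)"
      by (simp add: sin_i_times sinh_def exp_of_real[symmetric] scaleR_conv_of_real exp_minus)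
    moreover have "sinh x \<noteq> 0" using x by simp
    ultimately show ?thesis using y by (simp add: z_def field_simps)
  qed
  also have "(\<lambda>k. \<i> * ((inverse (of_nat (Suc k)) - inverse ((1 - z) + of_nat k)) - (inverse (of_nat (Suc k)) - inverse ((1 + z) + of_nat k))))
      = (\<lambda>k. of_real (2 * y / ((real (Suc k))\<^sup>2 + y\<^sup>2)))"
  proof
    fix k
    define m where "m = real (Suc k)"
    have m: "m > 0" by (simp add: m_def)
    have nz: "of_real m - z \<noteq> 0" "of_real m + z \<noteq> 0"
      using m by (auto simp: z_def complex_eq_iff)
    have d: "(of_real m - z) * (of_real m + z) = of_real (m\<^sup>2 + y\<^sup>2)"
      by (simp add: z_def power2_eq_square algebra_simps)
    have "\<i> * (inverse (of_real m + z) - inverse (of_real m - z)) = \<i> * (- 2 * z) / ((of_real m - z) * (of_real m + z))"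
      using nz by (simp add: field_simps)
    also have "\<i> * (- 2 * z) = of_real (2 * y)" by (simp add: z_def complex_eq_iff)
    also have "of_real (2 * y) / ((of_real m - z) * (of_real m + z)) = of_real (2 * y / (m\<^sup>2 + y\<^sup>2))"
      unfolding d by simp
    finally show "\<i> * ((inverse (of_nat (Suc k)) - inverse ((1 - z) + of_nat k)) - (inverse (of_nat (Suc k)) - inverse ((1 + z) + of_nat k)))
       = of_real (2 * y / ((real (Suc k))\<^sup>2 + y\<^sup>2))"
      by (simp add: m_def algebra_simps)
  qed
  finally have "(\<lambda>k. 2 * y / ((real (Suc k))\<^sup>2 + y\<^sup>2)) sums (pi * (cosh x / sinh x) - 1 / y)"
    by (simp only: sums_of_real_iff)
  from sums_divide[OF this, of pi]
  have "(\<lambda>k. 2 * y / ((real (Suc k))\<^sup>2 + y\<^sup>2) / pi) sums ((pi * (cosh x / sinh x) - 1 / y) / pi)" .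
  also have "(pi * (cosh x / sinh x) - 1 / y) / pi = cosh x / sinh x - 1 / x"
    using x by (simp add: y_def field_simps)
  also have "(\<lambda>k. 2 * y / ((real (Suc k))\<^sup>2 + y\<^sup>2) / pi) = (\<lambda>k. 2 * x / (x\<^sup>2 + (real (Suc k) * pi)\<^sup>2))"
  proof
    fix k
    define m where "m = real (Suc k)"
    have "m\<^sup>2 + y\<^sup>2 = (x\<^sup>2 + (m * pi)\<^sup>2) / pi\<^sup>2"
      by (simp add: y_def power_divide power_mult_distrib add_divide_distrib)
    then show "2 * y / ((real (Suc k))\<^sup>2 + y\<^sup>2) / pi = 2 * x / (x\<^sup>2 + (real (Suc k) * pi)\<^sup>2)"
      unfolding m_def[symmetric] by (simp add: y_def power2_eq_square)
  qed
  finally show ?thesis .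
qed

lemma sum_split_parity:
  fixes f :: "nat \<Rightarrow> 'a::comm_monoid_add"
  shows "(\<Sum>n<2*L. f n) = (\<Sum>k<L. f (2 * k)) + (\<Sum>k<L. f (2 * k + 1))"
  by (induction L) (simp_all add: add_ac)

lemma sums_even_positions:
  fixes f :: "nat \<Rightarrow> real"
  assumes "f sums s" "(\<lambda>k. f (2 * k + 1)) sums t"
  shows "(\<lambda>k. f (2 * k)) sums (s - t)"
proof -
  have "(\<lambda>L. \<Sum>n<2*L. f n) \<longlonglongrightarrow> s"
    using assms(1) unfolding sums_def by (rule filterlim_compose) (intro mult_nat_left_at_top, simp)
  moreover have "(\<lambda>L. \<Sum>k<L. f (2 * k + 1)) \<longlonglongrightarrow> t"
    using assms(2) unfolding sums_def .
  ultimately have "(\<lambda>L. (\<Sum>n<2*L. f n) - (\<Sum>k<L. f (2 * k + 1))) \<longlonglongrightarrow> s - t"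
    by (rule tendsto_diff)
  then show ?thesis by (simp add: sum_split_parity sums_def)
qed

lemma tanh_partial_fractions:
  fixes x :: real
  assumes x: "x > 0"
  shows "(\<lambda>k. 2 * x / (x\<^sup>2 + (real (2 * k + 1) * pi)\<^sup>2)) sums (tanh (x / 2) / 2)"
proof -
  \<comment> \<open>Half the series for x / 2 consists of the even multiples of pi. They sit at the
    odd positions 2k + 1, because position n carries the multiple n + 1.\<close>
  have "(\<lambda>k. 2 * (x / 2) / ((x / 2)\<^sup>2 + (real (Suc k) * pi)\<^sup>2) / 2) sums ((cosh (x / 2) / sinh (x / 2) - 1 / (x / 2)) / 2)"
    using x by (intro sums_divide coth_partial_fractions) simp
  also have "(\<lambda>k. 2 * (x / 2) / ((x / 2)\<^sup>2 + (real (Suc k) * pi)\<^sup>2) / 2) = (\<lambda>k. 2 * x / (x\<^sup>2 + (real (Suc (2 * k + 1)) * pi)\<^sup>2))"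
  proof
    fix k
    have "(x / 2)\<^sup>2 + (real (Suc k) * pi)\<^sup>2 = (x\<^sup>2 + (real (Suc (2 * k + 1)) * pi)\<^sup>2) / 4"
      by (simp add: power2_eq_square algebra_simps)
    moreover have "2 * (x / 2) / (D / 4) / 2 = 2 * x / D" for D :: real
      by (cases "D = 0") (simp_all add: field_simps)
    ultimately show "2 * (x / 2) / ((x / 2)\<^sup>2 + (real (Suc k) * pi)\<^sup>2) / 2 = 2 * x / (x\<^sup>2 + (real (Suc (2 * k + 1)) * pi)\<^sup>2)"
      by (simp only:)
  qed
  finally have "(\<lambda>k. 2 * x / (x\<^sup>2 + (real (Suc (2 * k)) * pi)\<^sup>2)) sums
     ((cosh x / sinh x - 1 / x) - (cosh (x / 2) / sinh (x / 2) - 1 / (x / 2)) / 2)"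
    by (rule sums_even_positions[OF coth_partial_fractions[OF x]])
  moreover have "(cosh x / sinh x - 1 / x) - (cosh (x / 2) / sinh (x / 2) - 1 / (x / 2)) / 2 = tanh (x / 2) / 2"
  proof -
    define c s where "c = cosh (x / 2)" and "s = sinh (x / 2)"
    have "cosh x = c\<^sup>2 + s\<^sup>2" "sinh x = 2 * s * c"
      using cosh_double[of "x / 2"] sinh_double[of "x / 2"] by (simp_all add: c_def s_def)
    moreover have "s > 0" "c > 0" using x by (auto simp: c_def s_def)
    ultimately show ?thesis
      using x unfolding tanh_def c_def[symmetric] s_def[symmetric] by (simp add: field_simps power2_eq_square)
  qed
  ultimately show ?thesis by (simp only: Suc_eq_plus1)
qed

lemma odd_inverse_squares_sums: "(\<lambda>k. 1 / (real (2 * k + 1))\<^sup>2) sums (pi\<^sup>2 / 8)"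
proof -
  have base: "(\<lambda>n. 1 / (real n + 1)\<^sup>2) sums (pi\<^sup>2 / 6)"
    using inverse_squares_sums by (simp add: add.commute)
  then have "(\<lambda>k. 1 / (real k + 1)\<^sup>2 / 4) sums (pi\<^sup>2 / 6 / 4)"
    by (rule sums_divide)
  also have "(\<lambda>k. 1 / (real k + 1)\<^sup>2 / 4) = (\<lambda>k. 1 / (real (2 * k + 1) + 1)\<^sup>2)"
  proof
    fix k
    have "(real (2 * k + 1) + 1)\<^sup>2 = (real k + 1)\<^sup>2 * 4" by (simp add: power2_eq_square algebra_simps)
    then show "1 / (real k + 1)\<^sup>2 / 4 = 1 / (real (2 * k + 1) + 1)\<^sup>2" by simp
  qed
  finally have "(\<lambda>k. 1 / (real (2 * k) + 1)\<^sup>2) sums (pi\<^sup>2 / 6 - pi\<^sup>2 / 6 / 4)"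
    by (rule sums_even_positions[OF base])
  then show ?thesis by (simp add: add.commute)
qed

text \<open>The full alternating series is twice the tanh series minus the coth series, over x, and
  coth x - tanh (x / 2) = 1 / sinh x. Terms decrease and the first is positive, so partial sums of
  odd length lie above the limit.\<close>

lemma csch_alternating_bound:
  fixes x :: real
  assumes x: "x > 0"
  shows "1 / x\<^sup>2 - 1 / (x * sinh x) \<le> (\<Sum>n<2*J+1. (- 1) ^ n * (2 / (x\<^sup>2 + (real (Suc n) * pi)\<^sup>2)))"
proof -
  define a where "a = (\<lambda>n. 2 / (x\<^sup>2 + (real (Suc n) * pi)\<^sup>2))"
  have "(\<lambda>k. 2 * x / (x\<^sup>2 + (real (Suc k) * pi)\<^sup>2) / x) sums ((cosh x / sinh x - 1 / x) / x)"
    by (intro sums_divide coth_partial_fractions x)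
  then have a_sums: "a sums ((cosh x / sinh x - 1 / x) / x)"
    using x by (simp add: a_def)
  have "(\<lambda>k. 2 * x / (x\<^sup>2 + (real (2 * k + 1) * pi)\<^sup>2) / x) sums (tanh (x / 2) / 2 / x)"
    by (intro sums_divide tanh_partial_fractions x)
  then have even: "(\<lambda>k. a (2 * k)) sums (tanh (x / 2) / 2 / x)"
    using x by (simp add: a_def add.commute)
  have lim0: "a \<longlonglongrightarrow> 0" using summable_LIMSEQ_zero[OF sums_summable[OF a_sums]] .
  have mono: "a (Suc n) \<le> a n" for n
    unfolding a_def using x by (intro divide_left_mono add_left_mono power_mono mult_right_mono mult_pos_pos add_pos_nonneg) auto
  have nonneg: "0 \<le> a n" for n by (simp add: a_def)
  note leib = summable_Leibniz'[OF lim0 nonneg mono]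
  have "(\<lambda>L. \<Sum>n<2*L. (- 1) ^ n * a n) \<longlonglongrightarrow> (\<Sum>n. (- 1) ^ n * a n)" by (rule leib(3))
  moreover have "(\<lambda>L. \<Sum>n<2*L. (- 1) ^ n * a n) \<longlonglongrightarrow> 2 * (tanh (x / 2) / 2 / x) - (cosh x / sinh x - 1 / x) / x"
  proof -
    have "(\<lambda>L. \<Sum>n<2*L. a n) \<longlonglongrightarrow> (cosh x / sinh x - 1 / x) / x"
      using a_sums unfolding sums_def by (rule filterlim_compose) (intro mult_nat_left_at_top, simp)
    moreover have "(\<lambda>L. \<Sum>k<L. a (2 * k)) \<longlonglongrightarrow> tanh (x / 2) / 2 / x"
      using even unfolding sums_def .
    ultimately have "(\<lambda>L. 2 * (\<Sum>k<L. a (2 * k)) - (\<Sum>n<2*L. a n)) \<longlonglongrightarrow> 2 * (tanh (x / 2) / 2 / x) - (cosh x / sinh x - 1 / x) / x"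
      by (intro tendsto_intros)
    then show ?thesis by (simp add: sum_split_parity sum_negf)
  qed
  ultimately have "(\<Sum>n. (- 1) ^ n * a n) = 2 * (tanh (x / 2) / 2 / x) - (cosh x / sinh x - 1 / x) / x"
    by (rule LIMSEQ_unique)
  also have "\<dots> = 1 / x\<^sup>2 - 1 / (x * sinh x)"
  proof -
    define c s where "c = cosh (x / 2)" and "s = sinh (x / 2)"
    have "cosh x = c\<^sup>2 + s\<^sup>2" "sinh x = 2 * s * c"
      using cosh_double[of "x / 2"] sinh_double[of "x / 2"] by (simp_all add: c_def s_def)
    moreover have "s > 0" "c > 0" using x by (auto simp: c_def s_def)
    moreover have "c\<^sup>2 - s\<^sup>2 = 1" by (simp add: c_def s_def hyperbolic_pythagoras)
    ultimately show ?thesis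
      using x unfolding tanh_def c_def[symmetric] s_def[symmetric]
      by (simp add: field_simps power2_eq_square)
  qed
  finally show ?thesis using leib(4)[of J] by (simp add: a_def)
qed

lemma alternating_tanh_le:
  fixes \<alpha> :: real
  assumes "\<alpha> > 0"
  shows "(\<Sum>n<2*J+1. (- 1) ^ n * (tanh (real (Suc n) * \<alpha>) / real (Suc n))) \<le> (\<Sum>n<2*J+1. (- 1) ^ n / real (Suc n))"
proof -
  define d where "d = (\<lambda>n. (1 - tanh (real (Suc n) * \<alpha>)) / real (Suc n))"
  have nonneg: "0 \<le> d n" for n
    unfolding d_def using tanh_real_lt_1[of "real (Suc n) * \<alpha>"] by simp
  have mono: "d (Suc n) \<le> d n" for n
    unfolding d_def using assms tanh_real_lt_1[of "real (Suc n) * \<alpha>"]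
    by (intro frac_le diff_left_mono) (auto simp: tanh_real_le_iff intro!: mult_right_mono)
  \<comment> \<open>Keeping the last term on the left is what makes the induction close: it pays for
    the next negative term.\<close>
  have "d (2 * J) \<le> (\<Sum>n<2*J+1. (- 1) ^ n * d n)"
  proof (induction J)
    case (Suc J)
    have e: "2 * Suc J + 1 = Suc (Suc (2 * J + 1))" "Suc (2 * J + 1) = 2 * Suc J" by simp_all
    have "(\<Sum>n<2*Suc J+1. (- 1) ^ n * d n) = (\<Sum>n<2*J+1. (- 1) ^ n * d n) + (d (2 * Suc J) - d (2 * J + 1))"
      unfolding e(1) sum.lessThan_Suc e(2) by simp
    then show ?case using Suc.IH mono[of "2 * J"] by simp
  qed simp
  then have "0 \<le> (\<Sum>n<2*J+1. (- 1) ^ n * d n)" using nonneg[of "2 * J"] by linarith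
  also have "\<dots> = (\<Sum>n<2*J+1. (- 1) ^ n / real (Suc n)) - (\<Sum>n<2*J+1. (- 1) ^ n * (tanh (real (Suc n) * \<alpha>) / real (Suc n)))"
    unfolding sum_subtractf[symmetric] d_def by (intro sum.cong refl) (simp add: diff_divide_distrib right_diff_distrib)
  finally show ?thesis by simp
qed

section \<open>Lower bound for the largest theta quotient\<close>

lemma ln_ratio_ge_partial_sum:
  fixes p :: real
  assumes "0 \<le> p" "p < 1"
  shows "2 * (\<Sum>m<K. p ^ (2 * m + 1) / real (2 * m + 1)) \<le> ln ((1 + p) / (1 - p))"
proof -
  have s: "(\<lambda>n. 2 * p ^ (2 * n + 1) / real (2 * n + 1)) sums (ln ((1 + p) / (1 - p)))"
    using ln_series_quadratic[of "(1 + p) / (1 - p)"] assms by (simp add: divide_simps)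
  have "(\<Sum>m<K. 2 * p ^ (2 * m + 1) / real (2 * m + 1)) \<le> (\<Sum>n. 2 * p ^ (2 * n + 1) / real (2 * n + 1))"
    using assms by (intro sum_le_suminf sums_summable[OF s]) auto
  then show ?thesis
    using s by (simp only: sum_distrib_left times_divide_eq_right sums_iff)
qed

text \<open>The logarithm of each factor is bounded below by K terms of its power series. After
  exchanging the sums, the geometric series over k tends to 1 / (2 sinh ((2m+1) h)); with K fixed,
  only a finite sum of limits is involved.\<close>

lemma ln_theta_quot_one_ge:
  fixes h :: real
  assumes h: "h > 0"
  shows "2 * (\<Sum>m<K. 1 / (real (2 * m + 1) * sinh (real (2 * m + 1) * h))) \<le> ln (theta_quot (exp (- h)) 1)"
proof -
  define q where "q = exp (- h)"
  have q: "0 < q" "q < 1" using h by (auto simp: q_def)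
  note pk = odd_power_less_1[OF q]
  let ?P = "\<lambda>n. \<Prod>k<n. ((1 + q ^ (2 * k + 1)) / (1 - q ^ (2 * k + 1)))\<^sup>2"
  have "theta_quot q 1 \<noteq> 0" using theta_quot_pos[OF q, of 1] by simp
  then have lim: "(\<lambda>n. ln (?P n)) \<longlonglongrightarrow> ln (theta_quot q 1)"
    by (intro tendsto_intros theta_quot_one_tendsto[OF q])
  define r where "r = (\<lambda>m. q ^ (2 * m + 1))"
  have r: "0 < r m" "r m < 1" for m using pk(2)[of m] q by (simp_all add: r_def)
  have rsum: "(\<lambda>n. \<Sum>k<n. r m ^ (2 * k + 1)) \<longlonglongrightarrow> 1 / (2 * sinh (real (2 * m + 1) * h))" for m
  proof -
    have "(\<lambda>k. r m * ((r m)\<^sup>2) ^ k) sums (r m * (1 / (1 - (r m)\<^sup>2)))"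
      using square_unit_interval[OF r] by (intro sums_mult geometric_sums) simp
    also have "(\<lambda>k. r m * ((r m)\<^sup>2) ^ k) = (\<lambda>k. r m ^ (2 * k + 1))"
      by (simp add: power_mult)
    also have "r m * (1 / (1 - (r m)\<^sup>2)) = 1 / (inverse (r m) - r m)"
      using r[of m] by (simp add: field_simps power2_eq_square)
    also have "inverse (r m) - r m = inverse (exp (- (real (2 * m + 1) * h))) - exp (- (real (2 * m + 1) * h))"
      unfolding r_def q_def by (simp only: exp_of_nat_mult[symmetric] mult_minus_right)
    also have "inverse (exp (- (real (2 * m + 1) * h))) - exp (- (real (2 * m + 1) * h)) = 2 * sinh (real (2 * m + 1) * h)"
      by (simp add: sinh_field_def exp_minus)
    finally show ?thesis by (simp only: sums_def)
  qed
  have lower: "(\<lambda>n. \<Sum>m<K. 4 / real (2 * m + 1) * (\<Sum>k<n. r m ^ (2 * k + 1)))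
     \<longlonglongrightarrow> (\<Sum>m<K. 4 / real (2 * m + 1) * (1 / (2 * sinh (real (2 * m + 1) * h))))"
    by (intro tendsto_intros rsum)
  have le: "(\<Sum>m<K. 4 / real (2 * m + 1) * (\<Sum>k<n. r m ^ (2 * k + 1))) \<le> ln (?P n)" for n
  proof -
    have pow: "r m ^ (2 * k + 1) = (q ^ (2 * k + 1)) ^ (2 * m + 1)" for m k
      unfolding r_def power_mult[symmetric] by (simp only: mult.commute)
    have "(\<Sum>m<K. 4 / real (2 * m + 1) * (\<Sum>k<n. r m ^ (2 * k + 1)))
        = (\<Sum>k<n. \<Sum>m<K. 4 / real (2 * m + 1) * r m ^ (2 * k + 1))"
      unfolding sum_distrib_left by (rule sum.swap)
    also have "\<dots> = (\<Sum>k<n. 2 * (2 * (\<Sum>m<K. (q ^ (2 * k + 1)) ^ (2 * m + 1) / real (2 * m + 1))))"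
      unfolding pow sum_distrib_left by (intro sum.cong refl) simp
    also have "\<dots> \<le> (\<Sum>k<n. 2 * ln ((1 + q ^ (2 * k + 1)) / (1 - q ^ (2 * k + 1))))"
      by (intro sum_mono mult_left_mono ln_ratio_ge_partial_sum pk) auto
    also have "\<dots> = (\<Sum>k<n. ln (((1 + q ^ (2 * k + 1)) / (1 - q ^ (2 * k + 1)))\<^sup>2))"
    proof (rule sum.cong[OF refl])
      fix k
      have "(1 + q ^ (2 * k + 1)) / (1 - q ^ (2 * k + 1)) > 0"
        using pk[of k] by (intro divide_pos_pos) linarith+
      then show "2 * ln ((1 + q ^ (2 * k + 1)) / (1 - q ^ (2 * k + 1))) = ln (((1 + q ^ (2 * k + 1)) / (1 - q ^ (2 * k + 1)))\<^sup>2)"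
        by (subst ln_realpow) simp_all
    qed
    also have "\<dots> = ln (?P n)"
    proof (rule ln_prod[symmetric])
      fix k
      have "(1 + q ^ (2 * k + 1)) / (1 - q ^ (2 * k + 1)) > 0"
        using pk[of k] by (intro divide_pos_pos) linarith+
      then show "((1 + q ^ (2 * k + 1)) / (1 - q ^ (2 * k + 1)))\<^sup>2 \<noteq> 0"
        by (intro power_not_zero) linarith
    qed simp
    finally show ?thesis .
  qed
  have "(\<Sum>m<K. 4 / real (2 * m + 1) * (1 / (2 * sinh (real (2 * m + 1) * h)))) \<le> ln (theta_quot q 1)"
    by (rule LIMSEQ_le[OF lower lim]) (use le in blast)
  then show ?thesis by (simp add: sum_distrib_left q_def)
qed

text \<open>Rescaling the tanh series at x = N pi^2 / h exchanges the roles of the two summation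
  indices. Here h turns into pi^2 / h, which is the imaginary transformation in this
  argument.\<close>

lemma sum_odd_inverse_quadratic_tendsto:
  fixes h :: real and n :: nat
  assumes h: "h > 0"
  shows "(\<lambda>K. \<Sum>m<K. h / ((real (2 * m + 1) * h)\<^sup>2 + (real (Suc n) * pi)\<^sup>2))
     \<longlonglongrightarrow> tanh (real (Suc n) * (pi\<^sup>2 / (2 * h))) / (4 * real (Suc n))"
proof -
  define N where "N = real (Suc n)"
  have N: "N > 0" by (simp add: N_def)
  define x where "x = N * (pi\<^sup>2 / h)"
  have x: "x > 0" using N h by (simp add: x_def)
  define c where "c = pi\<^sup>2 / h / (2 * x)"
  have "(\<lambda>m. c * (2 * x / (x\<^sup>2 + (real (2 * m + 1) * pi)\<^sup>2))) sums (c * (tanh (x / 2) / 2))"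
    by (intro sums_mult tanh_partial_fractions x)
  also have "(\<lambda>m. c * (2 * x / (x\<^sup>2 + (real (2 * m + 1) * pi)\<^sup>2))) = (\<lambda>m. h / ((real (2 * m + 1) * h)\<^sup>2 + (N * pi)\<^sup>2))"
  proof
    fix m
    define u where "u = real (2 * m + 1)"
    define W where "W = (u * h)\<^sup>2 + (N * pi)\<^sup>2"
    have D: "x\<^sup>2 + (u * pi)\<^sup>2 = pi\<^sup>2 / h\<^sup>2 * W"
      using h by (simp add: x_def W_def field_simps power2_eq_square)
    have "W > 0" unfolding W_def using N by (intro add_nonneg_pos) auto
    then have "c * (2 * x / (x\<^sup>2 + (u * pi)\<^sup>2)) = h / W"
      unfolding D c_def using x h by (simp add: field_simps power2_eq_square)
    then show "c * (2 * x / (x\<^sup>2 + (real (2 * m + 1) * pi)\<^sup>2)) = h / ((real (2 * m + 1) * h)\<^sup>2 + (N * pi)\<^sup>2)"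
      by (simp only: u_def W_def)
  qed
  also have "c * (tanh (x / 2) / 2) = tanh (N * (pi\<^sup>2 / (2 * h))) / (4 * N)"
    using N h by (simp add: c_def x_def field_simps)
  finally show ?thesis by (simp only: N_def sums_def)
qed

text \<open>In the bound by sums of 1 / (u sinh (u h)), each summand is estimated through its
  alternating partial fractions, cut at odd length. As K grows, the terms 1 / u^2 sum to pi^2 / (2
  h), and the rest becomes an alternating sum of tanh (n \<alpha>) / n, at most the harmonic one,
  which tends to ln 2 as J grows.\<close>

theorem theta_quot_one_lower_bound:
  fixes h :: real
  assumes h: "h > 0"
  shows "pi\<^sup>2 / (2 * h) - 2 * ln 2 \<le> 2 * ln (theta_quot (exp (- h)) 1)"
proof -
  define L where "L = 2 * ln (theta_quot (exp (- h)) 1)"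
  define \<alpha> where "\<alpha> = pi\<^sup>2 / (2 * h)"
  have \<alpha>: "\<alpha> > 0" using h by (simp add: \<alpha>_def)
  have bound: "\<alpha> - 2 * (\<Sum>n<2*J+1. (- 1) ^ n / real (Suc n)) \<le> L" for J
  proof -
    let ?t = "\<lambda>K n. \<Sum>m<K. h / ((real (2 * m + 1) * h)\<^sup>2 + (real (Suc n) * pi)\<^sup>2)"
    have "(\<lambda>K. 4 / h * (\<Sum>m<K. 1 / (real (2 * m + 1))\<^sup>2) - 8 * (\<Sum>n<2*J+1. (- 1) ^ n * ?t K n))
       \<longlonglongrightarrow> 4 / h * (pi\<^sup>2 / 8) - 8 * (\<Sum>n<2*J+1. (- 1) ^ n * (tanh (real (Suc n) * \<alpha>) / (4 * real (Suc n))))"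
      using odd_inverse_squares_sums unfolding sums_def \<alpha>_def
      by (intro tendsto_intros sum_odd_inverse_quadratic_tendsto[OF h])
    moreover have "4 / h * (\<Sum>m<K. 1 / (real (2 * m + 1))\<^sup>2) - 8 * (\<Sum>n<2*J+1. (- 1) ^ n * ?t K n) \<le> L" for K
    proof -
      have "8 * (\<Sum>n<2*J+1. (- 1) ^ n * ?t K n)
          = (\<Sum>m<K. 4 * h * (\<Sum>n<2*J+1. (- 1) ^ n * (2 / ((real (2 * m + 1) * h)\<^sup>2 + (real (Suc n) * pi)\<^sup>2))))"
        unfolding sum_distrib_left by (subst sum.swap) (intro sum.cong refl, simp)
      then have "4 / h * (\<Sum>m<K. 1 / (real (2 * m + 1))\<^sup>2) - 8 * (\<Sum>n<2*J+1. (- 1) ^ n * ?t K n)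
        = (\<Sum>m<K. 4 / h * (1 / (real (2 * m + 1))\<^sup>2) - 4 * h * (\<Sum>n<2*J+1. (- 1) ^ n * (2 / ((real (2 * m + 1) * h)\<^sup>2 + (real (Suc n) * pi)\<^sup>2))))"
        by (simp only: sum_subtractf sum_distrib_left)
      also have "\<dots> \<le> (\<Sum>m<K. 4 * (1 / (real (2 * m + 1) * sinh (real (2 * m + 1) * h))))"
      proof (rule sum_mono)
        fix m
        define u where "u = real (2 * m + 1)"
        have u: "u > 0" by (simp add: u_def)
        then have uh: "u * h > 0" using h by simp
        let ?S = "\<Sum>n<2*J+1. (- 1) ^ n * (2 / ((u * h)\<^sup>2 + (real (Suc n) * pi)\<^sup>2))"
        have "4 * h * (1 / (u * h)\<^sup>2 - 1 / (u * h * sinh (u * h))) \<le> 4 * h * ?S"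
          using h by (intro mult_left_mono csch_alternating_bound[OF uh]) auto
        moreover have "4 * h * (1 / (u * h)\<^sup>2 - 1 / (u * h * sinh (u * h))) = 4 / h * (1 / u\<^sup>2) - 4 * (1 / (u * sinh (u * h)))"
        proof -
          have "sinh (u * h) > 0" using uh by simp
          then show ?thesis using h u by (simp add: field_simps power2_eq_square)
        qed
        ultimately have "4 / h * (1 / u\<^sup>2) - 4 * h * ?S \<le> 4 * (1 / (u * sinh (u * h)))"
          by linarith
        then show "4 / h * (1 / (real (2 * m + 1))\<^sup>2) - 4 * h * (\<Sum>n<2*J+1. (- 1) ^ n * (2 / ((real (2 * m + 1) * h)\<^sup>2 + (real (Suc n) * pi)\<^sup>2)))
            \<le> 4 * (1 / (real (2 * m + 1) * sinh (real (2 * m + 1) * h)))"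
          by (simp only: u_def)
      qed
      also have "\<dots> \<le> L"
        using ln_theta_quot_one_ge[OF h, of K] unfolding sum_distrib_left[symmetric] L_def by linarith
      finally show ?thesis .
    qed
    ultimately have "4 / h * (pi\<^sup>2 / 8) - 8 * (\<Sum>n<2*J+1. (- 1) ^ n * (tanh (real (Suc n) * \<alpha>) / (4 * real (Suc n)))) \<le> L"
      by (intro LIMSEQ_le_const2) auto
    moreover have "4 / h * (pi\<^sup>2 / 8) = \<alpha>" by (simp add: \<alpha>_def)
    moreover have "8 * (\<Sum>n<2*J+1. (- 1) ^ n * (tanh (real (Suc n) * \<alpha>) / (4 * real (Suc n))))
       = 2 * (\<Sum>n<2*J+1. (- 1) ^ n * (tanh (real (Suc n) * \<alpha>) / real (Suc n)))"
    proof -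
      have "8 * (e * (t / (4 * s))) = 2 * (e * (t / s))" for e t s :: real by simp
      then show ?thesis unfolding sum_distrib_left by (intro sum.cong refl)
    qed
    ultimately show ?thesis using alternating_tanh_le[OF \<alpha>, of J] by linarith
  qed
  have "(\<lambda>J. \<Sum>n<2*J+1. (- 1) ^ n / real (Suc n)) \<longlonglongrightarrow> ln 2"
  proof (rule filterlim_compose[OF alternating_harmonic_series_sums[unfolded sums_def]])
    show "filterlim (\<lambda>J. 2 * J + 1) sequentially sequentially"
      by (rule filterlim_subseq) (simp add: strict_mono_def)
  qed
  then have "(\<lambda>J. \<alpha> - 2 * (\<Sum>n<2*J+1. (- 1) ^ n / real (Suc n))) \<longlonglongrightarrow> \<alpha> - 2 * ln 2"
    by (intro tendsto_intros)
  then have "\<alpha> - 2 * ln 2 \<le> L"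
    using bound by (intro LIMSEQ_le_const2) auto
  then show ?thesis by (simp only: L_def \<alpha>_def)
qed

theorem zolotarev_bound:
  fixes a b :: real
  assumes ab: "0 < a" "a < b"
  shows "\<exists>p. (\<forall>i. p i > 0) \<and>
    (\<forall>t\<in>{a..b}. (\<Prod>i<l. \<bar>(t - p i) / (t + p i)\<bar>) \<le> 2 * exp (- (real l * (pi\<^sup>2 / (2 * ln (4 * (b / a)))))))"
proof -
  \<comment> \<open>Chosen so that pi^2 / (2 h) = ln (4 (b / a)): the loss of 2 ln 2 in
    \<open>theta_quot_one_lower_bound\<close> then leaves exactly ln (b / a).\<close>
  define h where "h = pi\<^sup>2 / (2 * ln (4 * (b / a)))"
  have ba: "b / a > 1" using ab by simp
  then have lnpos: "ln (4 * (b / a)) > 0" by (intro ln_gt_zero) linarith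
  then have h: "h > 0" by (simp add: h_def)
  define q where "q = exp (- h)"
  have q: "0 < q" "q < 1" using h by (auto simp: q_def)
  define M where "M = theta_quot q 1"
  have M: "M > 0" unfolding M_def by (rule theta_quot_pos[OF q]) simp
  have "pi\<^sup>2 / (2 * h) = ln (4 * (b / a))" using lnpos by (simp add: h_def)
  also have "\<dots> = ln (2\<^sup>2) + ln (b / a)" using ba by (subst ln_mult_pos[symmetric]) auto
  also have "\<dots> = 2 * ln 2 + ln (b / a)" by (subst ln_realpow) auto
  finally have "ln (b / a) \<le> 2 * ln M"
    using theta_quot_one_lower_bound[OF h] by (simp add: M_def q_def)
  also have "\<dots> = ln (M\<^sup>2)" using M by (simp add: ln_realpow)
  finally have baM: "b / a \<le> M\<^sup>2" using ba M by (subst (asm) ln_le_cancel_iff) auto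
  \<comment> \<open>The geometric mean centres [a, b] multiplicatively. The values of s times the
    quotient fill [s / M, s M], which contains [a, b] once b / a \<le> M^2.\<close>
  define s where "s = sqrt (a * b)"
  have s: "s > 0" "s\<^sup>2 = a * b" using ab by (auto simp: s_def)
  have bs: "b \<le> M * s"
  proof (rule power2_le_imp_le)
    have "b * b \<le> M\<^sup>2 * a * b" using baM ab by (simp add: field_simps)
    then show "b\<^sup>2 \<le> (M * s)\<^sup>2" by (simp add: power_mult_distrib s power2_eq_square[of b])
  qed (use M s in simp)
  have as: "s \<le> M * a"
  proof (rule power2_le_imp_le)
    have "b \<le> M\<^sup>2 * a" using baM ab by (simp add: field_simps)
    then have "a * b \<le> a * (M\<^sup>2 * a)" using ab by (intro mult_left_mono) auto
    then show "s\<^sup>2 \<le> (M * a)\<^sup>2" by (simp add: power_mult_distrib s power2_eq_square[of a] mult_ac)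
  qed (use M ab in simp)
  define p where "p = (\<lambda>i. s * theta_quot q (minus_one_root l i))"
  have "p i > 0" for i
    using s theta_quot_pos[OF q, of "minus_one_root l i"] by (simp add: p_def)
  moreover have "(\<Prod>i<l. \<bar>(t - p i) / (t + p i)\<bar>) \<le> 2 * exp (- (real l * h))" if t: "t \<in> {a..b}" for t
  proof -
    have "1 / M \<le> t / s" "t / s \<le> M"
    proof -
      have "s \<le> M * t" using as t M by (meson atLeastAtMost_iff less_imp_le mult_left_mono order_trans)
      then show "1 / M \<le> t / s" using s M by (simp add: field_simps)
      show "t / s \<le> M" using bs t s by (simp add: field_simps)
    qed
    then obtain x where x: "norm x = 1" "theta_quot q x = t / s"
      unfolding M_def by (rule theta_quot_surj[OF q])
    have "(t - p i) / (t + p i) = (theta_quot q x - theta_quot q (minus_one_root l i)) / (theta_quot q x + theta_quot q (minus_one_root l i))" for i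
    proof -
      have ts: "t = s * theta_quot q x" using s by (simp add: x)
      show ?thesis unfolding ts p_def right_diff_distrib[symmetric] distrib_left[symmetric] using s by simp
    qed
    then have "(\<Prod>i<l. \<bar>(t - p i) / (t + p i)\<bar>) \<le> 2 * q ^ l"
      using theta_quot_blaschke_le[OF q x(1), of l] by (simp only:)
    also have "q ^ l = exp (- (real l * h))"
      unfolding q_def by (subst exp_of_nat_mult[symmetric]) simp
    finally show ?thesis .
  qed
  ultimately show ?thesis unfolding h_def[symmetric] by blast
qed

section \<open>Sylvester equations with low-rank right-hand side\<close>

lemma onb_bilinear_eqI:
  fixes A B :: "real^'n^'n"
  assumes "onb v" "onb w" and "\<And>i j. v i \<bullet> (A *v w j) = v i \<bullet> (B *v w j)"
  shows "A = B"
proof (rule onb_mat_eqI[OF assms(2)])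
  fix j
  have "A *v w j = (\<Sum>i\<in>UNIV. ((A *v w j) \<bullet> v i) *\<^sub>R v i)" by (simp only: onb_expand[OF assms(1)])
  also have "\<dots> = (\<Sum>i\<in>UNIV. ((B *v w j) \<bullet> v i) *\<^sub>R v i)" by (simp only: inner_commute[of _ "v _"] assms(3))
  also have "\<dots> = B *v w j" by (simp only: onb_expand[OF assms(1)])
  finally show "A *v w j = B *v w j" .
qed

lemma matfun_bilinear:
  assumes "onb v" "onb w"
  shows "v i \<bullet> ((matfun v g ** Y ** matfun w h) *v w j) = g i * h j * (v i \<bullet> (Y *v w j))"
  using sym_mat_inner[OF sym_mat_matfun[of v g], of "v i" "Y *v w j"]
  by (simp add: matrix_vector_mul_assoc[symmetric] eigenbasis_apply[OF eigenbasis_matfun[OF assms(1)]]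
      eigenbasis_apply[OF eigenbasis_matfun[OF assms(2)]] matrix_vector_mult_scaleR)

text \<open>In the bases \<open>v\<close>, \<open>w\<close> the hypothesis on \<open>D\<close> is the Sylvester equation \<open>P X + X Q = D\<close>
  with \<open>P\<close>, \<open>Q\<close> diagonal. One step replaces \<open>X\<close> by \<open>(P - p)(P + p)\<^sup>-\<^sup>1 X (Q - p)(Q + p)\<^sup>-\<^sup>1\<close>
  at the cost of the perturbation \<open>2p (P + p)\<^sup>-\<^sup>1 D (Q + p)\<^sup>-\<^sup>1\<close>.\<close>

lemma sylvester_rank_bound:
  fixes X D :: "real^'n^'n"
  assumes ob: "onb v" "onb w" and e: "\<And>i. e i > 0" and f: "\<And>i. f i > 0" and p: "\<And>k::nat. p k > 0"
    and D: "\<And>i j. v i \<bullet> (D *v w j) = (e i + f j) * (v i \<bullet> (X *v w j))"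
  shows "rank_bound (X - matfun v (\<lambda>i. \<Prod>k<l. (e i - p k) / (e i + p k)) ** X
            ** matfun w (\<lambda>i. \<Prod>k<l. (f i - p k) / (f i + p k))) (rank D * l)"
proof (induction l)
  case 0
  show ?case using rank_bound_0 by (simp add: matfun_one ob)
next
  case (Suc l)
  define C where "C = matfun v (\<lambda>i. (e i - p l) / (e i + p l))"
  define C' where "C' = matfun w (\<lambda>i. (f i - p l) / (f i + p l))"
  define R where "R = matfun v (\<lambda>i. \<Prod>k<l. (e i - p k) / (e i + p k))"
  define R' where "R' = matfun w (\<lambda>i. \<Prod>k<l. (f i - p k) / (f i + p k))"
  have R: "matfun v (\<lambda>i. \<Prod>k<Suc l. (e i - p k) / (e i + p k)) = C ** R"
    by (simp add: C_def R_def matfun_mult[OF ob(1)] mult.commute)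
  have R': "matfun w (\<lambda>i. \<Prod>k<Suc l. (f i - p k) / (f i + p k)) = R' ** C'"
    by (simp add: C'_def R'_def matfun_mult[OF ob(2)])
  have step: "X - C ** X ** C' = matfun v (\<lambda>i. 2 * p l / (e i + p l)) ** D ** matfun w (\<lambda>i. 1 / (f i + p l))"
  proof (rule onb_bilinear_eqI[OF ob])
    fix i j
    have "e i + p l \<noteq> 0" "f j + p l \<noteq> 0" using e[of i] f[of j] p[of l] by auto
    \<comment> \<open>The right-hand side contains the factor e_i + f_j, which turns an entry of X
      into one of D. This is why the difference has at most the rank of D.\<close>
    then have "1 - (e i - p l) / (e i + p l) * ((f j - p l) / (f j + p l))
        = 2 * p l / (e i + p l) * (1 / (f j + p l)) * (e i + f j)"
      by (simp add: divide_simps) (simp add: algebra_simps)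
    then have "x - (e i - p l) / (e i + p l) * ((f j - p l) / (f j + p l)) * x
        = 2 * p l / (e i + p l) * (1 / (f j + p l)) * ((e i + f j) * x)" for x
      by (metis (no_types, opaque_lifting) left_diff_distrib mult.assoc mult_1)
    then show "v i \<bullet> ((X - C ** X ** C') *v w j)
      = v i \<bullet> ((matfun v (\<lambda>i. 2 * p l / (e i + p l)) ** D ** matfun w (\<lambda>i. 1 / (f i + p l))) *v w j)"
      unfolding matrix_vector_mult_diff_rdistrib inner_diff_right C_def C'_def matfun_bilinear[OF ob] D .
  qed
  \<comment> \<open>Telescoping: the error of the new step plus the old error, multiplied on both
    sides by matrices that cannot raise its rank.\<close>
  have "X - (C ** R) ** X ** (R' ** C') = (X - C ** X ** C') + C ** (X - R ** X ** R') ** C'"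
    by (simp add: matrix_eq matrix_vector_mult_diff_rdistrib matrix_vector_mult_diff_distrib matrix_vector_mult_add_rdistrib
        matrix_vector_mul_assoc[symmetric])
  moreover have "rank D * Suc l = rank D + rank D * l" by simp
  moreover have "rank_bound (X - C ** X ** C') (rank D)"
    unfolding step by (rule rank_bound_mult[OF rank_bound_rank])
  moreover have "rank_bound (C ** (X - R ** X ** R') ** C') (rank D * l)"
    using Suc.IH unfolding R_def R'_def by (rule rank_bound_mult)
  ultimately show ?case
    unfolding R R' by (simp only: rank_bound_add)
qed

theorem theorem3:
  fixes A D :: "real^'n^'n" and j l :: nat
  assumes "pos_def A" and "pos_def (A + D)"
    and "j \<ge> 1" and "j + rank D * l \<le> CARD('n)"
  shows "let \<Delta> = mat_sqrt (A + D) - mat_sqrt A;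
             k = rank D;
             \<kappa> = 2 * (sqrt (norm2 A + norm2 D) + sqrt (lambda_min A) / 2) / sqrt (lambda_min A)
         in sing_val \<Delta> (j + k * l)
              \<le> 4 * (exp (pi\<^sup>2 / (2 * ln (4 * \<kappa>)))) powr (- 2 * real l) * sing_val \<Delta> j"
proof -
  note A = pos_def_imp_pos_semidef[OF assms(1)] and B = pos_def_imp_pos_semidef[OF assms(2)]
  define S where "S = mat_sqrt A"
  define T where "T = mat_sqrt (A + D)"
  have sS: "sym_mat S" and sT: "sym_mat T"
    using mat_sqrt(1)[OF A] mat_sqrt(1)[OF B] by (auto simp: S_def T_def pos_semidef_def)
  obtain v e where ve: "eigenbasis T v e" using sym_mat_eigenbasis_exists[OF sT] .
  obtain w f where wf: "eigenbasis S w f" using sym_mat_eigenbasis_exists[OF sS] .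
  note ob = eigenbasis_onb[OF ve] eigenbasis_onb[OF wf]
  note eb = mat_sqrt_eigenvalue_bounds[OF B ve[unfolded T_def]]
    and fb = mat_sqrt_eigenvalue_bounds[OF A wf[unfolded S_def]]
  \<comment> \<open>Half the lower bound 2a for the spectrum of S. Adding a to T, whose eigenvalues
    are at least 0, and subtracting it from S places both spectra in [a, N + a].\<close>
  define a where "a = sqrt (lambda_min A) / 2"
  define N where "N = sqrt (norm2 A + norm2 D)"
  define b where "b = N + a"
  have a: "a > 0" using lambda_min_pos[OF assms(1)] by (simp add: a_def)
  have eN: "e i \<le> N" for i
    using eb(2)[of i] norm2_add[of A D] by (simp add: N_def order_trans)
  have fN: "f i \<le> N" for i
    using fb(2)[of i] norm2_nonneg[of D] by (simp add: N_def order_trans)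
  have fa: "2 * a \<le> f i" for i using fb(3)[of i] by (simp add: a_def)
  have ab: "a < b" using fa[of undefined] fN[of undefined] a by (simp add: b_def)
  have e_ab: "e i + a \<in> {a..b}" for i using eb(1)[of i] eN[of i] by (simp add: b_def)
  have f_ab: "f i - a \<in> {a..b}" for i using fa[of i] fN[of i] a by (simp add: b_def)
  have kappa: "2 * (sqrt (norm2 A + norm2 D) + sqrt (lambda_min A) / 2) / sqrt (lambda_min A) = b / a"
    using a by (simp add: a_def b_def N_def field_simps)
  define h where "h = pi\<^sup>2 / (2 * ln (4 * (b / a)))"
  define r where "r = 2 * exp (- (real l * h))"
  obtain p where p: "\<And>i. p i > 0" and
    pr: "\<And>t. t \<in> {a..b} \<Longrightarrow> (\<Prod>i<l. \<bar>(t - p i) / (t + p i)\<bar>) \<le> r"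
    using zolotarev_bound[OF a ab, of l] unfolding r_def h_def by blast
  define X where "X = T - S"
  define R where "R = matfun v (\<lambda>i. \<Prod>k<l. ((e i + a) - p k) / ((e i + a) + p k))"
  define R' where "R' = matfun w (\<lambda>i. \<Prod>k<l. ((f i - a) - p k) / ((f i - a) + p k))"
  \<comment> \<open>In the bases v and w, the entries of D = T T - S S and X = T - S are e_i^2 -
    f_j^2 and e_i - f_j times v_i . w_j; the shifts by a cancel in the sum of the
    coefficients.\<close>
  have Dij: "v i \<bullet> (D *v w j) = ((e i + a) + (f j - a)) * (v i \<bullet> (X *v w j))" for i j
  proof -
    have "D = T ** T - S ** S" using mat_sqrt(2)[OF A] mat_sqrt(2)[OF B] by (simp add: S_def T_def)
    then have "v i \<bullet> (D *v w j) = (T *v v i) \<bullet> (T *v w j) - v i \<bullet> (S *v (S *v w j))"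
      by (simp add: matrix_vector_mult_diff_rdistrib inner_diff_right matrix_vector_mul_assoc[symmetric] sym_mat_inner[OF sT])
    also have "(T *v v i) \<bullet> (T *v w j) = e i * ((T *v v i) \<bullet> w j)"
      by (simp add: eigenbasis_apply[OF ve] sym_mat_inner[OF sT, symmetric] matrix_vector_mult_scaleR)
    finally have 1: "v i \<bullet> (D *v w j) = ((e i)\<^sup>2 - (f j)\<^sup>2) * (v i \<bullet> w j)"
      by (simp add: eigenbasis_apply[OF ve] eigenbasis_apply[OF wf] matrix_vector_mult_scaleR power2_eq_square algebra_simps)
    have "v i \<bullet> (X *v w j) = (T *v v i) \<bullet> w j - v i \<bullet> (S *v w j)"
      by (simp add: X_def matrix_vector_mult_diff_rdistrib inner_diff_right sym_mat_inner[OF sT])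
    then have 2: "v i \<bullet> (X *v w j) = (e i - f j) * (v i \<bullet> w j)"
      by (simp add: eigenbasis_apply[OF ve] eigenbasis_apply[OF wf] algebra_simps)
    show ?thesis unfolding 1 2 by (simp add: power2_eq_square algebra_simps)
  qed
  have cr: "rank_bound (X - R ** X ** R') (rank D * l)"
    unfolding R_def R'_def
  proof (rule sylvester_rank_bound[OF ob _ _ p Dij])
    show "e i + a > 0" for i using eb(1)[of i] a by simp
    show "f i - a > 0" for i using fa[of i] a by simp
  qed
  \<comment> \<open>\<open>sing_val\<close> counts from 1 and \<open>gain\<close> by codimension
    from 0, so index j corresponds to codimension j - 1.\<close>
  have j: "Suc (j - 1) = j" "j - 1 < CARD('n)" "j - 1 + rank D * l < CARD('n)"
    "Suc (j - 1 + rank D * l) = j + rank D * l"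
    using assms(3,4) by auto
  have "gain X (j - 1 + rank D * l) (r * r * sing_val X j)"
  proof (rule gain_perturb[OF _ cr])
    show "gain X (j - 1) (sing_val X j)" using gain_sing_val[OF j(2), of X] by (simp only: j)
    show "norm (R *v x) \<le> r * norm x" for x
      unfolding R_def by (rule norm_matfun_le[OF ob(1)]) (simp only: abs_prod pr[OF e_ab])
    show "norm (R' *v x) \<le> r * norm x" for x
      unfolding R'_def by (rule norm_matfun_le[OF ob(2)]) (simp only: abs_prod pr[OF f_ab])
    show "sing_val X j \<ge> 0" using sing_val_nonneg[OF j(2), of X] by (simp only: j)
  qed (simp add: r_def)
  from sing_val_le_gain[OF j(3) this]
  have "sing_val X (j + rank D * l) \<le> r * r * sing_val X j" by (simp only: j)
  \<comment> \<open>Each side of X contributes one factor r = 2 exp (- l h).\<close>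
  also have "r * r = 4 * exp h powr (- 2 * real l)"
    by (simp add: r_def powr_def mult_exp_exp)
  finally show ?thesis
    unfolding Let_def kappa by (simp only: X_def T_def S_def h_def)
qed

end
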